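(* Let $X$ be a complex Banach space, let $\mathcal{A}$ be a multivalued linear operator in $X$ satisfying condition (P) (stated in the context) with exponent $\beta\in(0,1]$, and let $(T(t))_{t>0}$ be the degenerate semigroup generated by $\mathcal{A}$. Suppose that $f\in APS^p(\mathbb{R}\times X:X)$ with $p>1$, and that there exist a number $r\ge\max(p,p/(p-1))$ and a function $L_f\in L^r_S(\mathbb{R})$ such that $$\|f(t,x)-f(t,y)\|\le L_f(t)\|x-y\|,\quad t\in\mathbb{R},\ x,y\in X.$$ Suppose that $\beta=1$ provided $r=p/(p-1)$, and that $\frac{pr}{pr-p-r}<\frac1{1-\beta}$ provided $r>p/(p-1)$. Set $q':=\infty$ provided $r=p/(p-1)$, and $q':=\frac{pr}{pr-p-r}$ provided $r>p/(p-1)$. Assume that $M:=\sum_{k=0}^\infty\|T(\cdot)\|_{L^{q'}[k,k+1]}<\infty$ and $M\|L_f\|_{S^r}<1$. Then there exists a unique almost periodic mild solution of the inclusion $$u'(t)\in\mathcal{A}u(t)+f(t,u(t)),\quad t\in\mathbb{R}.$$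
   Context: A multivalued linear operator (MLO) in $X$ is a map $\mathcal{A}:X\to P(X)$ whose graph $\{(x,y):y\in\mathcal{A}x\}$ is a linear subspace of $X\times X$ (with $D(\mathcal{A})=\{x:\mathcal{A}x\ne\emptyset\}$). Its resolvent set $\rho(\mathcal{A})$ is the set of $\lambda\in\mathbb{C}$ such that $R(\lambda-\mathcal{A})=X$ (range) and $R(\lambda:\mathcal{A}):=(\lambda-\mathcal{A})^{-1}$ is a single-valued bounded operator on $X$. Condition (P): there exist finite constants $c,M_0>0$ and $\beta\in(0,1]$ such that $\Psi:=\{\lambda\in\mathbb{C}:\Re\lambda\ge-c(|\Im\lambda|+1)\}\subseteq\rho(\mathcal{A})$ and $\|R(\lambda:\mathcal{A})\|\le M_0(1+|\lambda|)^{-\beta}$ for $\lambda\in\Psi$. Under (P), $\mathcal{A}$ generates a degenerate strongly continuous semigroup $(T(t))_{t>0}\subseteq L(X)$, given by $T(t)=\frac1{2\pi i}\int_\Gamma e^{\lambda t}R(\lambda:\mathcal{A})\,d\lambda$, $t>0$, where $\Gamma$ is the curve $\lambda=-c(|\eta|+1)+i\eta$, $\eta$ running from $-\infty$ to $\infty$; it satisfies $\|T(t)\|=O(e^{-ct}t^{\beta-1})$, $t>0$. A mild solution of the inclusion is a continuous function $u:\mathbb{R}\to X$ such that $u(t)=\int_{-\infty}^tT(t-s)f(s,u(s))\,ds$ for all $t\in\mathbb{R}$. Convention: $1/(1-\beta)=+\infty$ if $\beta=1$. $\|T(\cdot)\|_{L^{q'}[k,k+1]}$ is the $L^{q'}$-norm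 of $t\mapsto\|T(t)\|$ on $[k,k+1]$. $L^r_S(\mathbb{R})$ is the space of scalar functions $h\in L^r_{loc}(\mathbb{R})$ with $\|h\|_{S^r}:=\sup_{t\in\mathbb{R}}\left(\int_t^{t+1}|h(s)|^r\,ds\right)^{1/r}<\infty$. A continuous $u:\mathbb{R}\to X$ is almost periodic if for each $\epsilon>0$ there is $l>0$ such that every subinterval of $\mathbb{R}$ of length $l$ contains $\tau>0$ with $\|u(t+\tau)-u(t)\|\le\epsilon$ for all $t\in\mathbb{R}$. $APS^p(\mathbb{R}\times X:X)$ is the set of $f:\mathbb{R}\times X\to X$ such that $\hat f:\mathbb{R}\times X\to L^p([0,1]:X)$, $\hat f(t,x):=f(t+\cdot,x)$, is almost periodic, i.e. bounded, continuous, and such that for every $\epsilon>0$ and compact $K\subseteq X$ there is $l>0$ such that every subinterval of $\mathbb{R}$ of length $l$ contains $\tau$ with $\|\hat f(t+\tau,x)-\hat f(t,x)\|\le\epsilon$ for all $t\in\mathbb{R}$, $x\in K$.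
   Formalization: In the definition of almost periodic u, the requirement that every subinterval of ℝ of length l contain some τ>0 (impossible for intervals in the negative half-line) is replaced by Bohr's definition, with no sign condition on τ. *)

theory Defs
  imports "HOL-Analysis.Analysis" "HOL-Probability.Essential_Supremum"
begin

section \<open>Complex Banach spaces\<close>

class complex_normed_vector = real_normed_vector +
  fixes scaleC :: "complex \<Rightarrow> 'a \<Rightarrow> 'a"  (infixr "*\<^sub>C" 75)
  assumes scaleC_add_right: "z *\<^sub>C (x + y) = z *\<^sub>C x + z *\<^sub>C y"
    and scaleC_add_left: "(z + w) *\<^sub>C x = z *\<^sub>C x + w *\<^sub>C x"
    and scaleC_scaleC: "z *\<^sub>C w *\<^sub>C x = (z * w) *\<^sub>C x"
    and scaleC_of_real: "complex_of_real r *\<^sub>C x = r *\<^sub>R x"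
    and norm_scaleC: "norm (z *\<^sub>C x) = cmod z * norm x"

class complex_banach = complex_normed_vector + complete_space

subclass (in complex_banach) banach ..

instantiation complex :: complex_banach
begin
definition scaleC_complex :: "complex \<Rightarrow> complex \<Rightarrow> complex" where
  "scaleC_complex z w = z * w"
instance
  by standard (auto simp: scaleC_complex_def algebra_simps norm_mult scaleR_conv_of_real)
end

instantiation prod :: (complex_normed_vector, complex_normed_vector) complex_normed_vector
begin
definition scaleC_prod :: "complex \<Rightarrow> 'a \<times> 'b \<Rightarrow> 'a \<times> 'b" where
  "scaleC_prod z p = (z *\<^sub>C fst p, z *\<^sub>C snd p)"
instance
proof
  fix z :: complex and p :: "'a \<times> 'b"
  have "(norm (z *\<^sub>C p))\<^sup>2 = (cmod z * norm p)\<^sup>2"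
    by (simp add: scaleC_prod_def norm_prod_def norm_scaleC power_mult_distrib distrib_left)
  then show "norm (z *\<^sub>C p) = cmod z * norm p"
    by (simp add: power2_eq_iff_nonneg)
qed (auto simp: scaleC_prod_def scaleC_add_right scaleC_add_left scaleC_scaleC scaleC_of_real
      prod_eq_iff)
end

lemma bounded_linear_scaleC: "bounded_linear (\<lambda>x::'a::complex_normed_vector. z *\<^sub>C x)"
proof
  fix r :: real and x :: 'a
  show "z *\<^sub>C r *\<^sub>R x = r *\<^sub>R z *\<^sub>C x"
    by (simp add: scaleC_scaleC mult.commute flip: scaleC_of_real)
next
  show "\<exists>K. \<forall>x::'a. norm (z *\<^sub>C x) \<le> norm x * K"
    by (rule exI[of _ "cmod z"]) (simp add: norm_scaleC mult.commute)
qed (simp add: scaleC_add_right)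

instantiation blinfun :: (real_normed_vector, complex_normed_vector) complex_normed_vector
begin
definition scaleC_blinfun :: "complex \<Rightarrow> ('a \<Rightarrow>\<^sub>L 'b) \<Rightarrow> ('a \<Rightarrow>\<^sub>L 'b)" where
  "scaleC_blinfun z F = Blinfun (\<lambda>x. z *\<^sub>C blinfun_apply F x)"

lemma scaleC_blinfun_apply:
  "blinfun_apply (z *\<^sub>C F) x = z *\<^sub>C blinfun_apply F x" for F :: "'a \<Rightarrow>\<^sub>L 'b"
proof -
  have "bounded_linear (\<lambda>x. z *\<^sub>C blinfun_apply F x)"
    by (rule bounded_linear_compose[OF bounded_linear_scaleC blinfun.bounded_linear_right])
  then show ?thesis
    by (simp add: scaleC_blinfun_def bounded_linear_Blinfun_apply)
qed

instance
proof
  fix z :: complex and F :: "'a \<Rightarrow>\<^sub>L 'b"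
  have le: "norm (w *\<^sub>C G) \<le> cmod w * norm G" for w and G :: "'a \<Rightarrow>\<^sub>L 'b"
    by (rule norm_blinfun_bound)
      (auto simp: scaleC_blinfun_apply norm_scaleC mult.assoc intro!: mult_left_mono norm_blinfun)
  show "norm (z *\<^sub>C F) = cmod z * norm F"
  proof (cases "z = 0")
    case True
    then show ?thesis using le[of z F] by simp
  next
    case False
    have one: "1 *\<^sub>C y = y" for y :: 'b
      using scaleC_of_real[of 1 y] by simp
    have "inverse z *\<^sub>C z *\<^sub>C F = F"
      using False by (intro blinfun_eqI) (simp add: scaleC_blinfun_apply scaleC_scaleC one)
    then have "norm F \<le> cmod (inverse z) * norm (z *\<^sub>C F)"
      using le[of "inverse z" "z *\<^sub>C F"] by simp
    then have "cmod z * norm F \<le> norm (z *\<^sub>C F)"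
      using False by (simp add: norm_divide field_simps)
    with le[of z F] show ?thesis by simp
  qed
qed (auto intro!: blinfun_eqI simp: scaleC_blinfun_apply blinfun.add_left blinfun.scaleR_left
      scaleC_add_right scaleC_add_left scaleC_scaleC scaleC_of_real)
end

section \<open>Bochner integral and Lebesgue norms for functions into arbitrary Banach spaces\<close>

text \<open>
  The Bochner integral of the library is restricted to second countable target spaces. The
  following is the same construction for arbitrary normed target spaces; Borel measurability is
  replaced by strong measurability. It is used only with complete measures, so that
  the almost everywhere clause does not affect the measurability of norms.
\<close>

definition strongly_measurable :: "'a measure \<Rightarrow> ('a \<Rightarrow> 'b::real_normed_vector) \<Rightarrow> bool" where
  "strongly_measurable M f \<longleftrightarrow>
     (\<exists>s. (\<forall>i::nat. simple_function M (s i)) \<and> (AE x in M. (\<lambda>i. s i x) \<longlonglongrightarrow> f x))"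

definition has_vector_bochner_integral ::
    "'a measure \<Rightarrow> ('a \<Rightarrow> 'b::real_normed_vector) \<Rightarrow> 'b \<Rightarrow> bool" where
  "has_vector_bochner_integral M f I \<longleftrightarrow>
     strongly_measurable M f \<and>
     (\<exists>s. (\<forall>i::nat. Bochner_Integration.simple_bochner_integrable M (s i)) \<and>
          (\<lambda>i. \<integral>\<^sup>+x. ennreal (norm (f x - s i x)) \<partial>M) \<longlonglongrightarrow> 0 \<and>
          (\<lambda>i. Bochner_Integration.simple_bochner_integral M (s i)) \<longlonglongrightarrow> I)"

definition vector_bochner_integral ::
    "'a measure \<Rightarrow> ('a \<Rightarrow> 'b::real_normed_vector) \<Rightarrow> 'b" where
  "vector_bochner_integral M f = (THE I. has_vector_bochner_integral M f I)"

definition ennreal_root :: "real \<Rightarrow> ennreal \<Rightarrow> ennreal" where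
  "ennreal_root q x = (if x = \<infinity> then \<infinity> else ennreal (enn2real x powr (1 / q)))"

definition lp_norm :: "ennreal \<Rightarrow> 'a measure \<Rightarrow> ('a \<Rightarrow> 'b::real_normed_vector) \<Rightarrow> ennreal" where
  "lp_norm q M f =
     (if q = \<infinity> then esssup M (\<lambda>x. ennreal (norm (f x)))
      else ennreal_root (enn2real q) (\<integral>\<^sup>+x. ennreal (norm (f x) powr enn2real q) \<partial>M))"

definition lp_space :: "ennreal \<Rightarrow> 'a measure \<Rightarrow> ('a \<Rightarrow> 'b::real_normed_vector) set" where
  "lp_space q M = {f. strongly_measurable M f \<and> lp_norm q M f < \<infinity>}"

definition stepanov_norm :: "real \<Rightarrow> (real \<Rightarrow> real) \<Rightarrow> ennreal" where
  "stepanov_norm r h = (SUP t. lp_norm (ennreal r) (lebesgue_on {t..t+1}) h)"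

definition stepanov_space :: "real \<Rightarrow> (real \<Rightarrow> real) set" where
  "stepanov_space r =
     {h. (\<forall>a b. h \<in> lp_space (ennreal r) (lebesgue_on {a..b})) \<and> stepanov_norm r h < \<infinity>}"

section \<open>Multivalued linear operators\<close>

definition mlo :: "('a::complex_normed_vector \<Rightarrow> 'a set) \<Rightarrow> bool" where
  "mlo \<A> \<longleftrightarrow> module.subspace scaleC {(x, y). y \<in> \<A> x}"

definition mlo_shift :: "complex \<Rightarrow> ('a::complex_normed_vector \<Rightarrow> 'a set) \<Rightarrow> 'a \<Rightarrow> 'a set" where
  "mlo_shift z \<A> x = {z *\<^sub>C x - y | y. y \<in> \<A> x}"

definition mlo_range :: "('a \<Rightarrow> 'a set) \<Rightarrow> 'a set" where
  "mlo_range \<A> = (\<Union>x. \<A> x)"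

definition mlo_inverse :: "('a \<Rightarrow> 'a set) \<Rightarrow> 'a \<Rightarrow> 'a set" where
  "mlo_inverse \<A> y = {x. y \<in> \<A> x}"

text \<open>
  Bounded operators are represented by the library's real-linear type \<open>'a \<Rightarrow>\<^sub>L 'a\<close>. For an
  \<open>mlo\<close> the inverse of the shifted operator has a complex linear graph, so that an everywhere
  defined single-valued inverse is automatically complex linear; the operator norm is the same.
\<close>

definition resolvent_set :: "('a::complex_normed_vector \<Rightarrow> 'a set) \<Rightarrow> complex set" where
  "resolvent_set \<A> =
     {z. mlo_range (mlo_shift z \<A>) = UNIV \<and>
         (\<exists>R :: 'a \<Rightarrow>\<^sub>L 'a. \<forall>y. mlo_inverse (mlo_shift z \<A>) y = {blinfun_apply R y})}"

definition resolvent :: "('a::complex_normed_vector \<Rightarrow> 'a set) \<Rightarrow> complex \<Rightarrow> 'a \<Rightarrow>\<^sub>L 'a" where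
  "resolvent \<A> z = (THE R. \<forall>y. mlo_inverse (mlo_shift z \<A>) y = {blinfun_apply R y})"

definition Psi :: "real \<Rightarrow> complex set" where
  "Psi c = {z. Re z \<ge> - c * (\<bar>Im z\<bar> + 1)}"

definition condition_P ::
    "('a::complex_normed_vector \<Rightarrow> 'a set) \<Rightarrow> real \<Rightarrow> real \<Rightarrow> real \<Rightarrow> bool" where
  "condition_P \<A> c M\<^sub>0 \<beta> \<longleftrightarrow>
     c > 0 \<and> M\<^sub>0 > 0 \<and> 0 < \<beta> \<and> \<beta> \<le> 1 \<and> Psi c \<subseteq> resolvent_set \<A> \<and>
     (\<forall>z\<in>Psi c. norm (resolvent \<A> z) \<le> M\<^sub>0 * (1 + cmod z) powr (- \<beta>))"

definition Gamma_curve :: "real \<Rightarrow> real \<Rightarrow> complex" where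
  "Gamma_curve c \<eta> = Complex (- c * (\<bar>\<eta>\<bar> + 1)) \<eta>"

text \<open>
  The contour integral along \<open>Gamma_curve c\<close> is written out in the parameter \<open>\<eta>\<close>; the curve has
  derivative \<open>Complex (- c * sgn \<eta>) 1\<close> for \<open>\<eta> \<noteq> 0\<close>. Only the values at \<open>t > 0\<close> are meaningful.
\<close>

definition degenerate_semigroup ::
    "('a::complex_normed_vector \<Rightarrow> 'a set) \<Rightarrow> real \<Rightarrow> real \<Rightarrow> 'a \<Rightarrow>\<^sub>L 'a" where
  "degenerate_semigroup \<A> c t =
     (1 / (2 * complex_of_real pi * \<i>)) *\<^sub>C
     vector_bochner_integral lebesgue
       (\<lambda>\<eta>. (exp (Gamma_curve c \<eta> * complex_of_real t) * Complex (- c * sgn \<eta>) 1) *\<^sub>C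
             resolvent \<A> (Gamma_curve c \<eta>))"

section \<open>Almost periodicity and mild solutions\<close>

text \<open>
  The \<open>\<epsilon>\<close>-periods \<open>\<tau>\<close> are sought in every interval of length \<open>l\<close>, including intervals on the
  negative half-line, hence without a sign condition on \<open>\<tau>\<close>. As \<open>t\<close> ranges over the whole line, this
  is equivalent to looking for \<open>\<tau> > 0\<close> in the subintervals of the positive half-line.
\<close>

definition almost_periodic :: "(real \<Rightarrow> 'a::real_normed_vector) \<Rightarrow> bool" where
  "almost_periodic u \<longleftrightarrow>
     continuous_on UNIV u \<and>
     (\<forall>\<epsilon>>0. \<exists>l>0. \<forall>a. \<exists>\<tau>\<in>{a..a+l}. \<forall>t. norm (u (t + \<tau>) - u t) \<le> \<epsilon>)"

text \<open>
  Almost periodicity of the map sending \<open>(t, x)\<close> to the class of \<open>\<lambda>s. f (t + s) x\<close> in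
  \<open>L\<^sup>p([0,1]:X)\<close>, with the metric notions of that space written through the seminorm of the
  differences of representatives.
\<close>

definition APS :: "real \<Rightarrow> (real \<Rightarrow> 'a::real_normed_vector \<Rightarrow> 'b::real_normed_vector) set" where
  "APS p =
    {f. (let N = lp_norm (ennreal p) (lebesgue_on {0..1}) in
         (\<forall>t x. (\<lambda>s. f (t + s) x) \<in> lp_space (ennreal p) (lebesgue_on {0..1})) \<and>
         (\<exists>B::real. \<forall>t x. N (\<lambda>s. f (t + s) x) \<le> ennreal B) \<and>
         (\<forall>t x. ((\<lambda>(t', x'). N (\<lambda>s. f (t' + s) x' - f (t + s) x)) \<longlongrightarrow> 0) (at (t, x))) \<and>
         (\<forall>\<epsilon>>0. \<forall>K. compact K \<longrightarrow>
            (\<exists>l>0. \<forall>a. \<exists>\<tau>\<in>{a..a+l}. \<forall>t. \<forall>x\<in>K.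
               N (\<lambda>s. f (t + \<tau> + s) x - f (t + s) x) \<le> ennreal \<epsilon>)))}"

definition mild_solution ::
    "(real \<Rightarrow> 'a::real_normed_vector \<Rightarrow>\<^sub>L 'a) \<Rightarrow> (real \<Rightarrow> 'a \<Rightarrow> 'a) \<Rightarrow> (real \<Rightarrow> 'a) \<Rightarrow> bool" where
  "mild_solution T f u \<longleftrightarrow>
     continuous_on UNIV u \<and>
     (\<forall>t. has_vector_bochner_integral (lebesgue_on {..<t})
            (\<lambda>s. blinfun_apply (T (t - s)) (f s (u s))) (u t))"

end

theory Submission
  imports Defs
begin

text \<open>
  Almost periodic mild solutions are the almost periodic fixed points of
  \<open>(\<Phi> u) t = \<integral>\<^sub>0\<^sup>\<infinity> T(s) f(t - s, u(t - s)) ds\<close>. Condition (P) is needed only for the norm continuity of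
  \<open>T\<close> on the positive half-line, hence its strong measurability. Splitting the half-line into unit
  intervals and applying Hoelder's inequality on each of them bounds
  \<open>\<integral>\<^sub>0\<^sup>\<infinity> \<parallel>T(s)\<parallel> \<parallel>g(t - s)\<parallel> ds\<close> by \<open>M\<close> times the Stepanov norm of \<open>g\<close>, with exponent \<open>p\<close> as well as \<open>r\<close>,
  since \<open>1/q' + 1/p \<le> 1\<close> and \<open>1/q' + 1/r \<le> 1\<close>. With \<open>g = L\<^sub>f\<close> this makes \<open>\<Phi>\<close> a contraction in the supremum
  norm. It also shows that \<open>\<Phi>\<close> preserves almost periodicity: the range of \<open>u\<close> has a finite
  \<open>\<delta>\<close>-net \<open>K\<close>, the Lipschitz condition replaces \<open>u(t)\<close> by points of \<open>K\<close> at a cost proportional to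
  \<open>\<delta>\<close>, and there are common almost periods of \<open>u\<close> and of the functions \<open>f(\<cdot>, x)\<close>, \<open>x \<in> K\<close>.
\<close>

section \<open>Strong measurability\<close>

text \<open>The operator space that contains the values of \<open>T\<close> is in general not
  separable, so measurability means Borel measurability with essentially separable range;
  exceptional null sets occur throughout, which is why the measures have to be complete. The
  estimate \<open>solution_operator_shift_small\<close> is used twice: for all sufficiently small
  shifts it gives continuity of \<open>\<Phi> u\<close>, and for this uniform continuity has to be
  extracted from almost periodicity; for common almost periods it gives almost periodicity. Common
  periods are the delicate point, since two relatively dense sets of shifts may be disjoint; they
  exist here because the translates of \<open>u\<close> are totally bounded in the supremum norm.
  The net has to be finite because almost periods of \<open>f\<close> control a Stepanov norm for
  each fixed \<open>x\<close>, whereas under the integral \<open>x\<close> varies with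
  \<open>s\<close>: over finitely many points a supremum inside the integral is bounded by a
  sum.\<close>

lemma complete_measure_lebesgue_on:
  fixes S :: "'a::euclidean_space set"
  assumes "S \<in> sets lebesgue"
  shows "complete_measure (lebesgue_on S)"
proof
  fix A B :: "'a set" assume "B \<subseteq> A" "A \<in> null_sets (lebesgue_on S)"
  then have "A \<in> null_sets lebesgue" "A \<subseteq> S"
    using assms by (auto simp: null_sets_restrict_space)
  then have "B \<in> sets lebesgue" "B \<subseteq> S"
    using completion.complete[OF \<open>B \<subseteq> A\<close>] \<open>B \<subseteq> A\<close> by auto
  then show "B \<in> sets (lebesgue_on S)"
    using assms by (simp add: sets_restrict_space_iff)
qed

text \<open>Preimages under \<open>f\<close> and \<open>g\<close> differ by a subset of a null set,
  and such a set is measurable by completeness.\<close>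

lemma (in complete_measure) borel_measurable_AE_eq:
  fixes f g :: "'a \<Rightarrow> 'b::topological_space"
  assumes f: "f \<in> borel_measurable M" and eq: "AE x in M. f x = g x"
  shows "g \<in> borel_measurable M"
proof (rule measurableI)
  fix A :: "'b set" assume A: "A \<in> sets borel"
  show "g -` A \<inter> space M \<in> sets M"
  proof (rule in_sets_AE)
    show "f -` A \<inter> space M \<in> sets M" using f A by (rule measurable_sets)
    show "AE x in M. x \<in> f -` A \<inter> space M \<longleftrightarrow> x \<in> g -` A \<inter> space M"
      using eq by eventually_elim auto
  qed auto
qed simp

lemma borel_measurable_AE_LIMSEQ:
  fixes f :: "'a \<Rightarrow> 'b::real_normed_vector"
  assumes M: "complete_measure M" and g: "\<And>i::nat. g i \<in> borel_measurable M"
    and lim: "AE x in M. (\<lambda>i. g i x) \<longlonglongrightarrow> f x"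
  shows "f \<in> borel_measurable M"
proof -
  obtain N where lim': "\<And>x. x \<in> space M - N \<Longrightarrow> (\<lambda>i. g i x) \<longlonglongrightarrow> f x" and N: "N \<in> null_sets M"
    by (rule AE_E3[OF lim]) (rule that)
  have [measurable]: "N \<in> sets M" using N by auto
  \<comment> \<open>With both the sequence and the limit set to 0 on \<open>N\<close>, convergence
    holds at every point of the space.\<close>
  have "(\<lambda>x. if x \<in> N then 0 else f x) \<in> borel_measurable M"
  proof (rule borel_measurable_LIMSEQ_metric)
    show "(\<lambda>x. if x \<in> N then 0 else g i x) \<in> borel_measurable M" for i
      using g[of i] by simp
    show "(\<lambda>i. if x \<in> N then 0 else g i x) \<longlonglongrightarrow> (if x \<in> N then 0 else f x)" if "x \<in> space M" for x
      using lim' that by simp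
  qed
  then show ?thesis
    by (rule complete_measure.borel_measurable_AE_eq[OF M]) (use AE_not_in[OF N] in eventually_elim, simp)
qed

lemma strongly_measurable_AE_cong:
  assumes "strongly_measurable M f" and eq: "AE x in M. f x = g x"
  shows "strongly_measurable M g"
proof -
  obtain s where s: "\<And>i::nat. simple_function M (s i)" "AE x in M. (\<lambda>i. s i x) \<longlonglongrightarrow> f x"
    using assms(1) unfolding strongly_measurable_def by blast
  have "AE x in M. (\<lambda>i. s i x) \<longlonglongrightarrow> g x"
    using s(2) eq by eventually_elim simp
  then show ?thesis using s(1) unfolding strongly_measurable_def by blast
qed

lemma borel_measurable_dist_const:
  fixes f :: "'a \<Rightarrow> 'b::metric_space"
  assumes "f \<in> borel_measurable M"
  shows "(\<lambda>x. dist (f x) a) \<in> borel_measurable M"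
  by (rule measurable_compose[OF assms borel_measurable_continuous_onI]) (intro continuous_intros)

text \<open>The \<open>N\<close>-th approximation picks the first best approximant among \<open>N + 1\<close> points of the
  countable set.\<close>

lemma simple_function_sequence_separable:
  fixes f :: "'a \<Rightarrow> 'b::metric_space"
  assumes f: "f \<in> borel_measurable M" and D: "countable D" "\<And>x. x \<in> space M \<Longrightarrow> f x \<in> closure D"
  shows "\<exists>F. (\<forall>i::nat. simple_function M (F i)) \<and> (\<forall>x\<in>space M. (\<lambda>i. F i x) \<longlonglongrightarrow> f x)"
proof (cases "D = {}")
  case True
  then have "space M = {}" using D by auto
  then show ?thesis by (auto simp: simple_function_def)
next
  case False
  define e where "e = from_nat_into D"
  define P where "P N x n \<longleftrightarrow> n \<le> N \<and> (\<forall>m\<le>N. dist (f x) (e n) \<le> dist (f x) (e m))" for N x n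
  define k where "k N x = (LEAST n. P N x n)" for N x
  have [measurable]: "(\<lambda>x. dist (f x) a) \<in> borel_measurable M" for a
    by (rule borel_measurable_dist_const[OF f])
  have [measurable]: "Measurable.pred M (\<lambda>x. P N x n)" for N n
    unfolding P_def by measurable
  have k_meas: "k N \<in> measurable M (count_space UNIV)" for N
    unfolding k_def by measurable
  have ex: "\<exists>n. P N x n" for N x
  proof -
    have "finite ((\<lambda>m. dist (f x) (e m)) ` {..N})" "(\<lambda>m. dist (f x) (e m)) ` {..N} \<noteq> {}" by auto
    from Min_in[OF this] obtain n where "n \<le> N" "dist (f x) (e n) = Min ((\<lambda>m. dist (f x) (e m)) ` {..N})"
      unfolding image_iff by (metis atMost_iff)
    then show ?thesis unfolding P_def by (intro exI[of _ n]) auto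
  qed
  have k: "P N x (k N x)" for N x
    unfolding k_def using ex by (rule LeastI_ex)
  show ?thesis
  proof (intro exI[of _ "\<lambda>N x. e (k N x)"] conjI allI ballI)
    fix N
    have "simple_function M (k N)"
      unfolding simple_function_def
    proof
      have "k N ` space M \<subseteq> {..N}" using k by (auto simp: P_def)
      then show "finite (k N ` space M)" by (rule finite_subset) simp
      show "\<forall>y\<in>k N ` space M. k N -` {y} \<inter> space M \<in> sets M"
        using k_meas by (auto intro: measurable_sets)
    qed
    then show "simple_function M (\<lambda>x. e (k N x))"
      by (rule simple_function_compose1)
  next
    fix x assume x: "x \<in> space M"
    show "(\<lambda>N. e (k N x)) \<longlonglongrightarrow> f x"
    proof (rule metric_LIMSEQ_I)
      fix r :: real assume "0 < r"
      with D(2)[OF x] obtain d where "d \<in> D" "dist d (f x) < r"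
        unfolding closure_approachable by blast
      then obtain m where m: "dist (e m) (f x) < r"
        unfolding e_def using from_nat_into_surj[OF D(1)] by metis
      have "dist (e (k N x)) (f x) < r" if "N \<ge> m" for N
      proof -
        have "dist (f x) (e (k N x)) \<le> dist (f x) (e m)"
          using k[of N x] that unfolding P_def by blast
        then show ?thesis using m by (simp add: dist_commute)
      qed
      then show "\<exists>no. \<forall>n\<ge>no. dist (e (k n x)) (f x) < r" by blast
    qed
  qed
qed

text \<open>Pettis's criterion with Borel measurability in place of weak measurability. Forwards,
  the values of all approximating simple functions form the countable set; backwards,
  \<open>simple_function_sequence_separable\<close> supplies the approximation.\<close>

lemma strongly_measurable_iff:
  fixes f :: "'a \<Rightarrow> 'b::real_normed_vector"
  assumes M: "complete_measure M"
  shows "strongly_measurable M f \<longleftrightarrow>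
    f \<in> borel_measurable M \<and> (\<exists>D. countable D \<and> (AE x in M. f x \<in> closure D))"
proof safe
  assume "strongly_measurable M f"
  then obtain s where s: "\<And>i::nat. simple_function M (s i)" and lim: "AE x in M. (\<lambda>i. s i x) \<longlonglongrightarrow> f x"
    unfolding strongly_measurable_def by blast
  show "f \<in> borel_measurable M"
    by (rule borel_measurable_AE_LIMSEQ[OF M borel_measurable_simple_function[OF s] lim])
  show "\<exists>D. countable D \<and> (AE x in M. f x \<in> closure D)"
  proof (intro exI conjI)
    show "countable (\<Union>i. s i ` space M)"
      using s by (auto simp: simple_function_def countable_finite)
    show "AE x in M. f x \<in> closure (\<Union>i. s i ` space M)"
      using lim AE_space
    proof eventually_elim
      case (elim x)
      then show ?case unfolding closure_sequential by (intro exI[of _ "\<lambda>i. s i x"]) auto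
    qed
  qed
next
  fix D :: "'b set" assume f: "f \<in> borel_measurable M" and D: "countable D" "AE x in M. f x \<in> closure D"
  \<comment> \<open>\<open>f'\<close> takes its values in a separable set everywhere, not just
    almost everywhere. The point 0 is added to \<open>D\<close> so that the substitute value lies in
    the closure too.\<close>
  define f' where "f' x = (if f x \<in> closure (insert 0 D) then f x else 0)" for x
  have sub: "closure D \<subseteq> closure (insert 0 D)" by (intro closure_mono) auto
  have "f' \<in> borel_measurable M"
  proof -
    have "{x \<in> space M. f x \<in> closure (insert 0 D)} \<in> sets M"
      using measurable_sets[OF f, of "closure (insert 0 D)"] by (simp add: vimage_def Int_def conj_commute)
    then show ?thesis unfolding f'_def using f by (intro measurable_If) auto
  qed
  moreover have "f' x \<in> closure (insert 0 D)" for x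
    using closure_subset[of "insert 0 D"] unfolding f'_def by auto
  moreover have "countable (insert 0 D)" using D by simp
  ultimately obtain F where "\<And>i::nat. simple_function M (F i)" "\<And>x. x \<in> space M \<Longrightarrow> (\<lambda>i. F i x) \<longlonglongrightarrow> f' x"
    using simple_function_sequence_separable[of f' M "insert 0 D"] by metis
  then have "strongly_measurable M f'"
    unfolding strongly_measurable_def by (intro exI[of _ F]) auto
  then show "strongly_measurable M f"
    by (rule strongly_measurable_AE_cong) (use D(2) sub in \<open>auto simp: f'_def\<close>)
qed

lemma strongly_measurable_imp_borel:
  "complete_measure M \<Longrightarrow> strongly_measurable M f \<Longrightarrow> f \<in> borel_measurable M"
  by (simp add: strongly_measurable_iff)

section \<open>Closure properties of strong measurability\<close>

lemma strongly_measurable_second_countable: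
  fixes f :: "'a \<Rightarrow> 'b::{real_normed_vector,second_countable_topology}"
  assumes "f \<in> borel_measurable M"
  shows "strongly_measurable M f"
  using borel_measurable_implies_sequence_metric[OF assms, of 0] unfolding strongly_measurable_def
  by auto

text \<open>The criterion replaces a diagonal choice among double sequences of simple functions: the
  union of the countable sets belonging to the \<open>g i\<close> works for the limit.\<close>

lemma strongly_measurable_LIMSEQ:
  assumes M: "complete_measure M" and g: "\<And>i::nat. strongly_measurable M (g i)"
    and lim: "AE x in M. (\<lambda>i. g i x) \<longlonglongrightarrow> f x"
  shows "strongly_measurable M f"
  unfolding strongly_measurable_iff[OF M]
proof
  show "f \<in> borel_measurable M"
    by (rule borel_measurable_AE_LIMSEQ[OF M strongly_measurable_imp_borel[OF M g] lim])
  have "\<forall>i. \<exists>D. countable D \<and> (AE x in M. g i x \<in> closure D)"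
    using g unfolding strongly_measurable_iff[OF M] by blast
  then obtain D where D: "\<And>i. countable (D i)" "\<And>i. AE x in M. g i x \<in> closure (D i)" by metis
  have "AE x in M. \<forall>i. g i x \<in> closure (D i)" using D(2) by (simp add: AE_all_countable)
  then have "AE x in M. f x \<in> closure (\<Union>i. D i)"
    using lim
  proof eventually_elim
    case (elim x)
    have "closure (D i) \<subseteq> closure (\<Union>i. D i)" for i by (intro closure_mono) auto
    then show ?case
      using elim(1) by (intro Lim_in_closed_set[OF closed_closure _ _ elim(2)]) (auto intro!: always_eventually)
  qed
  then show "\<exists>D. countable D \<and> (AE x in M. f x \<in> closure D)"
    using D(1) by (intro exI[of _ "\<Union>i. D i"]) auto
qed

lemma strongly_measurable_compose2:
  assumes f: "strongly_measurable M f" and g: "strongly_measurable M g"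
    and p: "continuous_on UNIV (\<lambda>z. p (fst z) (snd z))"
  shows "strongly_measurable M (\<lambda>x. p (f x) (g x))"
proof -
  obtain s where s: "\<And>i::nat. simple_function M (s i)" "AE x in M. (\<lambda>i. s i x) \<longlonglongrightarrow> f x"
    using f unfolding strongly_measurable_def by blast
  obtain r where r: "\<And>i::nat. simple_function M (r i)" "AE x in M. (\<lambda>i. r i x) \<longlonglongrightarrow> g x"
    using g unfolding strongly_measurable_def by blast
  have "AE x in M. (\<lambda>i. p (s i x) (r i x)) \<longlonglongrightarrow> p (f x) (g x)"
    using s(2) r(2)
  proof eventually_elim
    case (elim x)
    from continuous_on_tendsto_compose[OF p tendsto_Pair[OF this]] show ?case by simp
  qed
  then show ?thesis
    using s(1) r(1) unfolding strongly_measurable_def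
    by (intro exI[of _ "\<lambda>i x. p (s i x) (r i x)"]) (auto intro: simple_function_compose2)
qed

lemma strongly_measurable_diff:
  "strongly_measurable M f \<Longrightarrow> strongly_measurable M g \<Longrightarrow> strongly_measurable M (\<lambda>x. f x - g x)"
  by (rule strongly_measurable_compose2) (auto intro!: continuous_intros)

lemma strongly_measurable_add:
  "strongly_measurable M f \<Longrightarrow> strongly_measurable M g \<Longrightarrow> strongly_measurable M (\<lambda>x. f x + g x)"
  by (rule strongly_measurable_compose2) (auto intro!: continuous_intros)

lemma strongly_measurable_scaleR:
  "strongly_measurable M a \<Longrightarrow> strongly_measurable M f \<Longrightarrow> strongly_measurable M (\<lambda>x. a x *\<^sub>R f x)"
  by (rule strongly_measurable_compose2) (auto intro!: continuous_intros)

lemma strongly_measurable_simple_function: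
  "simple_function M s \<Longrightarrow> strongly_measurable M s"
  unfolding strongly_measurable_def by (intro exI[of _ "\<lambda>_. s"]) auto

lemma strongly_measurable_sum:
  "finite I \<Longrightarrow> (\<And>i. i \<in> I \<Longrightarrow> strongly_measurable M (f i)) \<Longrightarrow> strongly_measurable M (\<lambda>x. \<Sum>i\<in>I. f i x)"
  by (induction I rule: finite_induct) (auto intro: strongly_measurable_add strongly_measurable_simple_function)

text \<open>Meant for the superposition \<open>f s (u s)\<close>. With a simple function in place of
  \<open>u\<close> the composite is a finite sum of the functions \<open>g _ y\<close>, each cut off
  to a level set; continuity in the second variable handles the limit.\<close>

lemma strongly_measurable_Caratheodory:
  assumes M: "complete_measure M" and g: "\<And>y. strongly_measurable M (\<lambda>x. g x y)"
    and cont: "\<And>x. continuous_on UNIV (g x)" and u: "strongly_measurable M u"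
  shows "strongly_measurable M (\<lambda>x. g x (u x))"
proof -
  obtain s where s: "\<And>i::nat. simple_function M (s i)" "AE x in M. (\<lambda>i. s i x) \<longlonglongrightarrow> u x"
    using u unfolding strongly_measurable_def by blast
  show ?thesis
  proof (rule strongly_measurable_LIMSEQ[OF M])
    fix i
    have "strongly_measurable M (\<lambda>x. \<Sum>y\<in>s i ` space M. indicator (s i -` {y} \<inter> space M) x *\<^sub>R g x y)"
      using simple_functionD[OF s(1)]
      by (intro strongly_measurable_sum strongly_measurable_scaleR strongly_measurable_simple_function
          simple_function_indicator g) auto
    moreover have "(\<Sum>y\<in>s i ` space M. indicator (s i -` {y} \<inter> space M) x *\<^sub>R g x y) = g x (s i x)"
      if "x \<in> space M" for x
    proof -
      have "(\<Sum>y\<in>s i ` space M. indicator (s i -` {y} \<inter> space M) x *\<^sub>R g x y) =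
        (\<Sum>y\<in>s i ` space M. if y = s i x then g x y else 0)"
        using that by (intro sum.cong) (auto simp: indicator_def)
      then show ?thesis using that simple_functionD(1)[OF s(1)[of i]] by simp
    qed
    ultimately show "strongly_measurable M (\<lambda>x. g x (s i x))"
      by (rule strongly_measurable_AE_cong[OF _ AE_I2])
  next
    show "AE x in M. (\<lambda>i. g x (s i x)) \<longlonglongrightarrow> g x (u x)"
      using s(2)
    proof eventually_elim
      case (elim x)
      then show ?case using continuous_on_tendsto_compose[OF cont] by auto
    qed
  qed
qed

lemma strongly_measurable_blinfun_apply:
  "strongly_measurable M T \<Longrightarrow> strongly_measurable M g \<Longrightarrow>
    strongly_measurable M (\<lambda>x. blinfun_apply (T x) (g x))"
  by (rule strongly_measurable_compose2[of M _ _ blinfun_apply]) (auto intro!: continuous_intros)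

section \<open>Restriction, gluing and continuous functions\<close>

lemma strongly_measurable_restrict_space:
  assumes "strongly_measurable M f" "S \<in> sets M"
  shows "strongly_measurable (restrict_space M S) f"
proof -
  obtain s where s: "\<And>i::nat. simple_function M (s i)" "AE x in M. (\<lambda>i. s i x) \<longlonglongrightarrow> f x"
    using assms(1) unfolding strongly_measurable_def by blast
  have "simple_function (restrict_space M S) (s i)" for i
    unfolding simple_function_def
  proof safe
    show "finite (s i ` space (restrict_space M S))"
      using simple_functionD(1)[OF s(1)]
      by (rule rev_finite_subset) (auto simp: space_restrict_space)
    show "s i -` {s i x} \<inter> space (restrict_space M S) \<in> sets (restrict_space M S)" for x
    proof -
      have "s i -` {s i x} \<inter> space M \<in> sets M"
        using simple_functionD(2)[OF s(1)] by blast
      then have "S \<inter> (s i -` {s i x} \<inter> space M) \<in> sets (restrict_space M S)"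
        by (auto simp: sets_restrict_space)
      then show ?thesis by (simp add: space_restrict_space Int_ac)
    qed
  qed
  moreover have "AE x in restrict_space M S. (\<lambda>i. s i x) \<longlonglongrightarrow> f x"
    using s(2) assms(2) by (subst AE_restrict_space_iff) auto
  ultimately show ?thesis unfolding strongly_measurable_def by blast
qed

text \<open>The assumptions on \<open>f\<close> and \<open>L\<^sub>f\<close> are local. Countability
  of the cover keeps the union of the exceptional sets null and the union of the countable dense
  sets countable.\<close>

lemma strongly_measurable_lebesgue_cover:
  fixes f :: "'a::euclidean_space \<Rightarrow> 'b::real_normed_vector"
  assumes C: "countable C" "\<And>S. S \<in> C \<Longrightarrow> S \<in> sets lebesgue" "\<Union>C = UNIV"
    and f: "\<And>S. S \<in> C \<Longrightarrow> strongly_measurable (lebesgue_on S) f"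
  shows "strongly_measurable lebesgue f"
proof -
  have cm: "complete_measure (lebesgue :: 'a measure)" by (rule completion.complete_measure_axioms)
  have *: "f \<in> borel_measurable (lebesgue_on S) \<and> (\<exists>D. countable D \<and> (AE x in lebesgue_on S. f x \<in> closure D))"
    if "S \<in> C" for S
    using strongly_measurable_iff[OF complete_measure_lebesgue_on[OF C(2)[OF that]], of f] f[OF that] by blast
  have "f \<in> borel_measurable lebesgue"
  proof (rule measurable_piecewise_restrict[OF C(1)])
    show "S \<inter> space lebesgue \<in> sets lebesgue" if "S \<in> C" for S using C(2)[OF that] by simp
    show "space lebesgue \<subseteq> \<Union>C" using C(3) by simp
    show "f \<in> borel_measurable (lebesgue_on S)" if "S \<in> C" for S using *[OF that] by blast
  qed
  moreover have "\<exists>D. countable D \<and> (AE x in lebesgue. f x \<in> closure D)"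
  proof -
    have "\<forall>S\<in>C. \<exists>D. countable D \<and> (AE x in lebesgue_on S. f x \<in> closure D)" using * by blast
    then obtain D where D: "\<And>S. S \<in> C \<Longrightarrow> countable (D S)"
      "\<And>S. S \<in> C \<Longrightarrow> AE x in lebesgue_on S. f x \<in> closure (D S)" by metis
    have "AE x in lebesgue. \<forall>S\<in>C. x \<in> S \<longrightarrow> f x \<in> closure (D S)"
    proof (subst AE_ball_countable[OF C(1)], rule ballI)
      fix S assume S: "S \<in> C"
      show "AE x in lebesgue. x \<in> S \<longrightarrow> f x \<in> closure (D S)"
        using D(2)[OF S] C(2)[OF S] by (subst (asm) AE_restrict_space_iff) auto
    qed
    then have "AE x in lebesgue. f x \<in> closure (\<Union>S\<in>C. D S)"
    proof eventually_elim
      case (elim x)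
      obtain S where "S \<in> C" "x \<in> S" using C(3) by blast
      then have "f x \<in> closure (D S)" "closure (D S) \<subseteq> closure (\<Union>S\<in>C. D S)"
        using elim by (auto intro!: closure_mono)
      then show ?case by blast
    qed
    then show ?thesis using D(1) C(1) by (intro exI[of _ "\<Union>S\<in>C. D S"]) auto
  qed
  ultimately show ?thesis using strongly_measurable_iff[OF cm] by blast
qed

text \<open>Any subset of a Euclidean space is separable, and a continuous map sends a countable
  dense subset to a dense subset of its range. Hence the target itself need not be
  separable.\<close>

lemma strongly_measurable_continuous_on:
  fixes f :: "'a::euclidean_space \<Rightarrow> 'b::real_normed_vector"
  assumes S: "S \<in> sets lebesgue" and f: "continuous_on S f"
  shows "strongly_measurable (lebesgue_on S) f"
proof -
  obtain D where D: "countable D" "D \<subseteq> S" "S \<subseteq> closure D"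
    using separable[of S] by blast
  have "f ` S \<subseteq> closure (f ` D)"
  proof
    fix y assume "y \<in> f ` S"
    then obtain x where x: "x \<in> S" "y = f x" by blast
    then obtain X where X: "\<And>n. X n \<in> D" "X \<longlonglongrightarrow> x"
      using D(3) by (metis closure_sequential subsetD)
    have "(\<lambda>n. f (X n)) \<longlonglongrightarrow> f x"
      using continuous_on_tendsto_compose[OF f X(2) x(1)] X(1) D(2) by (auto intro!: always_eventually)
    then show "y \<in> closure (f ` D)"
      unfolding closure_sequential x(2) using X(1) by (intro exI[of _ "\<lambda>n. f (X n)"]) auto
  qed
  then have "AE x in lebesgue_on S. f x \<in> closure (f ` D)"
    by (intro AE_I2) (auto simp: space_restrict_space)
  moreover have "f \<in> borel_measurable (lebesgue_on S)"
  proof (rule borel_measurableI)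
    fix U :: "'b set" assume "open U"
    then obtain A where "open A" "A \<inter> S = f -` U \<inter> S"
      using f unfolding continuous_on_open_invariant by blast
    then have "f -` U \<inter> S \<in> sets (lebesgue_on S)"
      by (auto simp: sets_restrict_space intro!: image_eqI[of _ _ A])
    then show "f -` U \<inter> space (lebesgue_on S) \<in> sets (lebesgue_on S)" by simp
  qed
  ultimately show ?thesis
    using D(1) unfolding strongly_measurable_iff[OF complete_measure_lebesgue_on[OF S]] by blast
qed

section \<open>The Bochner integral\<close>

lemma simple_bochner_integral_norm_le:
  assumes "Bochner_Integration.simple_bochner_integrable M s"
  shows "ennreal (norm (Bochner_Integration.simple_bochner_integral M s)) \<le> (\<integral>\<^sup>+x. ennreal (norm (s x)) \<partial>M)"
proof -
  have "Bochner_Integration.simple_bochner_integrable M (\<lambda>x. norm (s x))"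
    using assms simple_bochner_integrable_compose2[of "\<lambda>x y. norm x" M s s] by simp
  then show ?thesis
    using simple_bochner_integral_norm_bound[OF assms] simple_bochner_integral_eq_nn_integral
    by (metis ennreal_leI norm_ge_zero)
qed

lemma borel_measurable_norm_diff_strongly:
  assumes "complete_measure M" "strongly_measurable M f" "strongly_measurable M g"
  shows "(\<lambda>x. norm (f x - g x)) \<in> borel_measurable M"
  using strongly_measurable_imp_borel[OF assms(1) strongly_measurable_diff[OF assms(2,3)]] by simp

lemma simple_bochner_integral_diff_norm_le:
  assumes "Bochner_Integration.simple_bochner_integrable M s" "Bochner_Integration.simple_bochner_integrable M t"
  shows "ennreal (norm (Bochner_Integration.simple_bochner_integral M s - Bochner_Integration.simple_bochner_integral M t))
    \<le> (\<integral>\<^sup>+x. ennreal (norm (s x - t x)) \<partial>M)"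
  using simple_bochner_integral_norm_le[of M "\<lambda>x. s x - t x"] assms
  by (simp add: simple_bochner_integral_diff simple_bochner_integrable_compose2)

text \<open>Formulated for a difference, the bound yields uniqueness (\<open>f = g\<close>),
  continuity in parameters and all later comparisons of two integrals. It holds for simple
  approximants and passes to the limit.\<close>

lemma has_vector_bochner_integral_diff_norm_le:
  assumes M: "complete_measure M"
    and f: "has_vector_bochner_integral M f I" and g: "has_vector_bochner_integral M g J"
  shows "ennreal (norm (I - J)) \<le> (\<integral>\<^sup>+x. ennreal (norm (f x - g x)) \<partial>M)"
proof -
  let ?I = "Bochner_Integration.simple_bochner_integral M"
  obtain s where s: "\<And>i::nat. Bochner_Integration.simple_bochner_integrable M (s i)"
    "(\<lambda>i. \<integral>\<^sup>+x. ennreal (norm (f x - s i x)) \<partial>M) \<longlonglongrightarrow> 0" "(\<lambda>i. ?I (s i)) \<longlonglongrightarrow> I"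
    using f unfolding has_vector_bochner_integral_def by blast
  obtain t where t: "\<And>i::nat. Bochner_Integration.simple_bochner_integrable M (t i)"
    "(\<lambda>i. \<integral>\<^sup>+x. ennreal (norm (g x - t i x)) \<partial>M) \<longlonglongrightarrow> 0" "(\<lambda>i. ?I (t i)) \<longlonglongrightarrow> J"
    using g unfolding has_vector_bochner_integral_def by blast
  have sm: "strongly_measurable M f" "strongly_measurable M g"
    "strongly_measurable M (s i)" "strongly_measurable M (t i)" for i
    using f g s(1)[of i] t(1)[of i] unfolding has_vector_bochner_integral_def
    by (auto intro: strongly_measurable_simple_function elim: simple_bochner_integrable.cases)
  note [measurable] = borel_measurable_norm_diff_strongly[OF M sm(1) sm(3)]
    borel_measurable_norm_diff_strongly[OF M sm(2) sm(4)] borel_measurable_norm_diff_strongly[OF M sm(1) sm(2)]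
  have le: "ennreal (norm (?I (s i) - ?I (t i))) \<le>
    (\<integral>\<^sup>+x. ennreal (norm (f x - s i x)) \<partial>M) + (\<integral>\<^sup>+x. ennreal (norm (f x - g x)) \<partial>M) +
    (\<integral>\<^sup>+x. ennreal (norm (g x - t i x)) \<partial>M)" for i
  proof -
    have "ennreal (norm (?I (s i) - ?I (t i))) \<le> (\<integral>\<^sup>+x. ennreal (norm (s i x - t i x)) \<partial>M)"
      using s(1) t(1) by (rule simple_bochner_integral_diff_norm_le)
    also have "\<dots> \<le> (\<integral>\<^sup>+x. ennreal (norm (f x - s i x)) + ennreal (norm (f x - g x)) + ennreal (norm (g x - t i x)) \<partial>M)"
    proof (rule nn_integral_mono)
      fix x
      have "norm (s i x - t i x) = norm ((f x - g x) - (f x - s i x) + (g x - t i x))" by simp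
      also have "\<dots> \<le> norm (f x - s i x) + norm (f x - g x) + norm (g x - t i x)"
        by (smt (verit) norm_triangle_ineq norm_triangle_ineq4)
      finally show "ennreal (norm (s i x - t i x)) \<le> ennreal (norm (f x - s i x)) + ennreal (norm (f x - g x)) + ennreal (norm (g x - t i x))"
        by (simp flip: ennreal_plus)
    qed
    also have "\<dots> = (\<integral>\<^sup>+x. ennreal (norm (f x - s i x)) \<partial>M) + (\<integral>\<^sup>+x. ennreal (norm (f x - g x)) \<partial>M) +
    (\<integral>\<^sup>+x. ennreal (norm (g x - t i x)) \<partial>M)"
      by (subst nn_integral_add; (subst nn_integral_add)?) measurable
    finally show ?thesis .
  qed
  have "(\<lambda>i. (\<integral>\<^sup>+x. ennreal (norm (f x - s i x)) \<partial>M) + (\<integral>\<^sup>+x. ennreal (norm (f x - g x)) \<partial>M) +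
    (\<integral>\<^sup>+x. ennreal (norm (g x - t i x)) \<partial>M)) \<longlonglongrightarrow> 0 + (\<integral>\<^sup>+x. ennreal (norm (f x - g x)) \<partial>M) + 0"
    by (intro tendsto_add s t tendsto_const)
  moreover have "(\<lambda>i. ennreal (norm (?I (s i) - ?I (t i)))) \<longlonglongrightarrow> ennreal (norm (I - J))"
    by (intro tendsto_ennrealI tendsto_norm tendsto_diff s t)
  ultimately show ?thesis
    using le by (auto intro: LIMSEQ_le)
qed

lemma has_vector_bochner_integral_unique:
  assumes "complete_measure M"
    and "has_vector_bochner_integral M f I" and "has_vector_bochner_integral M f J"
  shows "I = J"
  using has_vector_bochner_integral_diff_norm_le[OF assms] by simp

lemma vector_bochner_integral_eq:
  assumes "complete_measure M" "has_vector_bochner_integral M f I"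
  shows "vector_bochner_integral M f = I"
  unfolding vector_bochner_integral_def
  using assms has_vector_bochner_integral_unique by blast

lemma has_vector_bochner_integral_exists:
  fixes f :: "'a \<Rightarrow> 'b::banach"
  assumes M: "complete_measure M" and f: "strongly_measurable M f"
    and fin: "(\<integral>\<^sup>+x. ennreal (norm (f x)) \<partial>M) < \<infinity>"
  shows "has_vector_bochner_integral M f (vector_bochner_integral M f)"
proof -
  let ?I = "Bochner_Integration.simple_bochner_integral M"
  obtain s where s: "\<And>i::nat. simple_function M (s i)" and lim: "AE x in M. (\<lambda>i. s i x) \<longlonglongrightarrow> f x"
    using f unfolding strongly_measurable_def by blast
  note [measurable] = strongly_measurable_imp_borel[OF M f] borel_measurable_simple_function[OF s]
  \<comment> \<open>Values exceeding twice the norm of the limit are cut to 0. Where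
    \<open>f x\<close> is nonzero this eventually changes nothing, and where \<open>f x = 0\<close>
    it forces \<open>r i x = 0\<close>, so convergence survives; in return
    \<open>3 * norm (f x)\<close> dominates the errors.\<close>
  define r where "r i x = (if norm (s i x) \<le> 2 * norm (f x) then s i x else 0)" for i x
  have r_simple: "simple_function M (r i)" for i
  proof -
    have "simple_function M (\<lambda>x. if x \<in> {x \<in> space M. norm (s i x) \<le> 2 * norm (f x)} then s i x else 0)"
      by (intro simple_function_If_set s simple_function_const) measurable
    then show ?thesis
      by (rule simple_function_cong[THEN iffD1, rotated]) (auto simp: r_def)
  qed
  have r_norm: "norm (r i x) \<le> 2 * norm (f x)" for i x by (simp add: r_def)
  have r_lim: "AE x in M. (\<lambda>i. r i x) \<longlonglongrightarrow> f x"
    using lim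
  proof eventually_elim
    case (elim x)
    show ?case
    proof (cases "f x = 0")
      case True
      then have "r i x = 0" for i by (simp add: r_def)
      then show ?thesis using True by simp
    next
      case False
      have "\<forall>\<^sub>F i in sequentially. norm (s i x) < 2 * norm (f x)"
        using False by (intro order_tendstoD(2)[OF tendsto_norm[OF elim]]) auto
      then have "\<forall>\<^sub>F i in sequentially. s i x = r i x" by eventually_elim (simp add: r_def)
      then show ?thesis by (rule Lim_transform_eventually[OF elim])
    qed
  qed
  have [measurable]: "(\<lambda>x. norm (f x - r i x)) \<in> borel_measurable M" for i
    by (intro borel_measurable_norm_diff_strongly M f strongly_measurable_simple_function r_simple)
  have r_int: "Bochner_Integration.simple_bochner_integrable M (r i)" for i
  proof (rule simple_bochner_integrableI_bounded[OF r_simple])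
    have "(\<integral>\<^sup>+x. ennreal (norm (r i x)) \<partial>M) \<le> (\<integral>\<^sup>+x. 2 * ennreal (norm (f x)) \<partial>M)"
      using r_norm by (intro nn_integral_mono) (metis ennreal_leI ennreal_mult' ennreal_numeral zero_le_numeral)
    also have "\<dots> = 2 * (\<integral>\<^sup>+x. ennreal (norm (f x)) \<partial>M)" by (intro nn_integral_cmult) measurable
    also have "\<dots> < \<infinity>" using fin by (simp add: ennreal_mult_less_top)
    finally show "(\<integral>\<^sup>+x. ennreal (norm (r i x)) \<partial>M) < \<infinity>" .
  qed
  have conv: "(\<lambda>i. \<integral>\<^sup>+x. ennreal (norm (f x - r i x)) \<partial>M) \<longlonglongrightarrow> 0"
  proof -
    have "(\<lambda>i. \<integral>\<^sup>+x. ennreal (norm (f x - r i x)) \<partial>M) \<longlonglongrightarrow> (\<integral>\<^sup>+x. 0 \<partial>M)"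
    proof (rule nn_integral_dominated_convergence[where w="\<lambda>x. 3 * ennreal (norm (f x))"])
      show "AE x in M. ennreal (norm (f x - r j x)) \<le> 3 * ennreal (norm (f x))" for j
      proof (intro AE_I2)
        fix x
        have "norm (f x - r j x) \<le> norm (f x) + norm (r j x)" by (rule norm_triangle_ineq4)
        also have "\<dots> \<le> 3 * norm (f x)" using r_norm[of j x] by simp
        finally show "ennreal (norm (f x - r j x)) \<le> 3 * ennreal (norm (f x))"
          by (metis ennreal_leI ennreal_mult' ennreal_numeral zero_le_numeral)
      qed
      show "(\<integral>\<^sup>+x. 3 * ennreal (norm (f x)) \<partial>M) < \<infinity>"
        using fin by (subst nn_integral_cmult) (auto simp: ennreal_mult_less_top)
      show "AE x in M. (\<lambda>i. ennreal (norm (f x - r i x))) \<longlonglongrightarrow> 0"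
        using r_lim
      proof eventually_elim
        case (elim x)
        have "(\<lambda>i. norm (f x - r i x)) \<longlonglongrightarrow> 0"
          using tendsto_norm[OF tendsto_diff[OF tendsto_const[of "f x"] elim]] by simp
        from tendsto_ennrealI[OF this] show ?case by simp
      qed
    qed measurable
    then show ?thesis by simp
  qed
  have "Cauchy (\<lambda>i. ?I (r i))"
  proof (rule metric_CauchyI)
    fix e :: real assume "0 < e"
    then have "\<forall>\<^sub>F i in sequentially. (\<integral>\<^sup>+x. ennreal (norm (f x - r i x)) \<partial>M) < ennreal (e / 2)"
      by (intro order_tendstoD(2)[OF conv]) auto
    then obtain N where N: "\<And>i. i \<ge> N \<Longrightarrow> (\<integral>\<^sup>+x. ennreal (norm (f x - r i x)) \<partial>M) < ennreal (e / 2)"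
      unfolding eventually_sequentially by blast
    have "dist (?I (r m)) (?I (r n)) < e" if "m \<ge> N" "n \<ge> N" for m n
    proof -
      have "ennreal (norm (?I (r m) - ?I (r n))) \<le> (\<integral>\<^sup>+x. ennreal (norm (r m x - r n x)) \<partial>M)"
        by (intro simple_bochner_integral_diff_norm_le r_int)
      also have "\<dots> \<le> (\<integral>\<^sup>+x. ennreal (norm (f x - r m x)) + ennreal (norm (f x - r n x)) \<partial>M)"
      proof (rule nn_integral_mono)
        fix x
        have "norm (r m x - r n x) = norm ((f x - r n x) - (f x - r m x))" by simp
        also have "\<dots> \<le> norm (f x - r m x) + norm (f x - r n x)"
          by (metis add.commute norm_triangle_ineq4)
        finally show "ennreal (norm (r m x - r n x)) \<le> ennreal (norm (f x - r m x)) + ennreal (norm (f x - r n x))"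
          by (simp flip: ennreal_plus)
      qed
      also have "\<dots> = (\<integral>\<^sup>+x. ennreal (norm (f x - r m x)) \<partial>M) + (\<integral>\<^sup>+x. ennreal (norm (f x - r n x)) \<partial>M)"
        by (rule nn_integral_add) measurable
      also have "\<dots> < ennreal (e / 2) + ennreal (e / 2)"
        using N that by (intro add_strict_mono) auto
      also have "\<dots> = ennreal e" using \<open>0 < e\<close> by (simp flip: ennreal_plus)
      finally show ?thesis using \<open>0 < e\<close> by (simp add: dist_norm ennreal_less_iff)
    qed
    then show "\<exists>N. \<forall>m\<ge>N. \<forall>n\<ge>N. dist (?I (r m)) (?I (r n)) < e" by blast
  qed
  then obtain I where I: "(\<lambda>i. ?I (r i)) \<longlonglongrightarrow> I"
    using Cauchy_convergent_iff convergent_def by blast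
  have "has_vector_bochner_integral M f I"
    unfolding has_vector_bochner_integral_def using f r_int conv I by blast
  then show ?thesis using vector_bochner_integral_eq[OF M] by metis
qed

section \<open>Image measures\<close>

lemma simple_function_distr_compose:
  assumes s: "simple_function (distr N L \<phi>) s"
    and \<phi>: "\<phi> \<in> measurable N L" and surj: "\<phi> ` space N = space L"
  shows "simple_function N (\<lambda>x. s (\<phi> x))"
  unfolding simple_function_def
proof safe
  show "finite ((\<lambda>x. s (\<phi> x)) ` space N)"
    using s surj by (simp add: simple_function_def image_image[symmetric])
  show "(\<lambda>x. s (\<phi> x)) -` {s (\<phi> x)} \<inter> space N \<in> sets N" for x
  proof -
    have "s -` {s (\<phi> x)} \<inter> space L \<in> sets L"
      using simple_functionD(2)[OF s, of "{s (\<phi> x)}"] by simp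
    from measurable_sets[OF \<phi> this]
    have "\<phi> -` (s -` {s (\<phi> x)} \<inter> space L) \<inter> space N \<in> sets N" .
    moreover have "\<phi> -` (s -` {s (\<phi> x)} \<inter> space L) \<inter> space N = (\<lambda>x. s (\<phi> x)) -` {s (\<phi> x)} \<inter> space N"
      using surj by auto
    ultimately show ?thesis by simp
  qed
qed

lemma strongly_measurable_distr_compose:
  assumes f: "strongly_measurable (distr N L \<phi>) f"
    and \<phi>: "\<phi> \<in> measurable N L" and surj: "\<phi> ` space N = space L"
  shows "strongly_measurable N (\<lambda>x. f (\<phi> x))"
proof -
  obtain r where "\<And>i::nat. simple_function (distr N L \<phi>) (r i)"
    "AE x in distr N L \<phi>. (\<lambda>i. r i x) \<longlonglongrightarrow> f x"
    using f unfolding strongly_measurable_def by blast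
  then show ?thesis
    unfolding strongly_measurable_def
    by (intro exI[of _ "\<lambda>i x. r i (\<phi> x)"])
      (auto intro: simple_function_distr_compose[OF _ \<phi> surj] AE_distrD[OF \<phi>])
qed

text \<open>Since \<open>\<phi>\<close> is onto, a simple function and its pullback have the same
  finite set of values and level sets of equal measure. The approximating sequence therefore pulls
  back with the same integrals and the same errors.\<close>

lemma has_vector_bochner_integral_distr:
  assumes f: "has_vector_bochner_integral (distr N L \<phi>) f I" and L: "complete_measure (distr N L \<phi>)"
    and \<phi>: "\<phi> \<in> measurable N L" and surj: "\<phi> ` space N = space L"
  shows "has_vector_bochner_integral N (\<lambda>x. f (\<phi> x)) I"
proof -
  let ?M = "distr N L \<phi>"
  note simple = simple_function_distr_compose[OF _ \<phi> surj]
  have meas: "emeasure N {x \<in> space N. P (\<phi> x)} = emeasure ?M {x \<in> space ?M. P x}"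
    if "{x \<in> space L. P x} \<in> sets L" for P
  proof -
    have "\<phi> -` {x \<in> space L. P x} \<inter> space N = {x \<in> space N. P (\<phi> x)}" using surj by auto
    then show ?thesis using emeasure_distr[OF \<phi> that] by simp
  qed
  obtain s where s: "\<And>i::nat. Bochner_Integration.simple_bochner_integrable ?M (s i)"
    "(\<lambda>i. \<integral>\<^sup>+x. ennreal (norm (f x - s i x)) \<partial>?M) \<longlonglongrightarrow> 0"
    "(\<lambda>i. Bochner_Integration.simple_bochner_integral ?M (s i)) \<longlonglongrightarrow> I"
    and sm: "strongly_measurable ?M f"
    using f unfolding has_vector_bochner_integral_def by blast
  have s': "simple_function ?M (s i)" "emeasure ?M {y \<in> space ?M. s i y \<noteq> 0} \<noteq> \<infinity>" for i
    using s(1)[of i] by (auto elim: simple_bochner_integrable.cases)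
  have sets_s: "{x \<in> space L. s i x \<in> A} \<in> sets L" for i A
    using simple_functionD(2)[OF s'(1)[of i], of A] by (simp add: vimage_def Int_def conj_commute)
  have "strongly_measurable N (\<lambda>x. f (\<phi> x))"
    by (rule strongly_measurable_distr_compose[OF sm \<phi> surj])
  moreover have "Bochner_Integration.simple_bochner_integrable N (\<lambda>x. s i (\<phi> x))" for i
    using simple[OF s'(1)] s'(2)[of i] meas[of "\<lambda>x. s i x \<noteq> 0"] sets_s[of i "- {0}"]
    by (intro simple_bochner_integrable.intros) auto
  moreover have "(\<integral>\<^sup>+x. ennreal (norm (f (\<phi> x) - s i (\<phi> x))) \<partial>N) = (\<integral>\<^sup>+x. ennreal (norm (f x - s i x)) \<partial>?M)" for i
  proof (rule nn_integral_distr[OF \<phi>, symmetric])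
    have "(\<lambda>x. norm (f x - s i x)) \<in> borel_measurable ?M"
      by (intro borel_measurable_norm_diff_strongly L sm strongly_measurable_simple_function s')
    then show "(\<lambda>x. ennreal (norm (f x - s i x))) \<in> borel_measurable ?M" by measurable
  qed
  moreover have "Bochner_Integration.simple_bochner_integral N (\<lambda>x. s i (\<phi> x)) = Bochner_Integration.simple_bochner_integral ?M (s i)" for i
  proof -
    have "(\<lambda>x. s i (\<phi> x)) ` space N = s i ` space ?M"
      using surj by (simp add: image_image[symmetric])
    moreover have "measure N {x \<in> space N. s i (\<phi> x) = y} = measure ?M {x \<in> space ?M. s i x = y}" for y
      using meas[of "\<lambda>x. s i x = y"] sets_s[of i "{y}"] by (simp add: measure_def)
    ultimately show ?thesis by (simp add: Bochner_Integration.simple_bochner_integral_def)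
  qed
  ultimately show ?thesis
    unfolding has_vector_bochner_integral_def
    using s by (intro conjI exI[of _ "\<lambda>i x. s i (\<phi> x)"]) auto
qed

section \<open>Affine changes of variable on the line\<close>

lemma lebesgue_measurable_real_affine:
  fixes c :: real
  assumes "c \<noteq> 0"
  shows "(\<lambda>x. t + c * x) \<in> measurable lebesgue lebesgue"
  using lebesgue_affine_measurable[where c="\<lambda>x::real. c" and t=t] assms by simp

lemma lebesgue_measurable_reflect: "(\<lambda>x::real. t - x) \<in> measurable lebesgue lebesgue"
  using lebesgue_measurable_real_affine[of "-1" t] by simp

lemma lebesgue_measurable_translate: "(\<lambda>x::real. t + x) \<in> measurable lebesgue lebesgue"
  using lebesgue_measurable_real_affine[of 1 t] by simp

lemma emeasure_lebesgue_reflect: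
  fixes t :: real
  assumes "A \<in> sets lebesgue"
  shows "emeasure lebesgue ((\<lambda>x. t - x) -` A) = emeasure lebesgue A"
proof -
  have "emeasure lebesgue A = (\<integral>\<^sup>+x. indicator A x \<partial>lebesgue)"
    using assms by simp
  also have "\<dots> = (\<integral>\<^sup>+x. indicator A (t - x) \<partial>lebesgue)"
    using nn_integral_real_affine_lebesgue[of "indicator A" "-1" t] assms by simp
  also have "\<dots> = (\<integral>\<^sup>+x. indicator ((\<lambda>x. t - x) -` A) x \<partial>lebesgue)"
    by (simp add: indicator_def)
  also have "\<dots> = emeasure lebesgue ((\<lambda>x. t - x) -` A)"
    using measurable_sets[OF lebesgue_measurable_reflect assms, of t] by simp
  finally show ?thesis ..
qed

text \<open>The reflection exchanges \<open>{..<t}\<close> and \<open>{0<..}\<close>, the two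
  domains of integration for mild solutions; two reflections compose to a translation, which is how
  translates are treated later.\<close>

lemma distr_lebesgue_on_reflect:
  fixes t :: real
  assumes S: "S \<in> sets lebesgue"
  shows "distr (lebesgue_on ((\<lambda>x. t - x) -` S)) (lebesgue_on S) (\<lambda>x. t - x) = lebesgue_on S"
    and "(\<lambda>x. t - x) \<in> measurable (lebesgue_on ((\<lambda>x. t - x) -` S)) (lebesgue_on S)"
proof -
  let ?R = "(\<lambda>x. t - x) -` S"
  have R: "?R \<in> sets lebesgue"
    using measurable_sets[OF lebesgue_measurable_reflect S] by simp
  show meas: "(\<lambda>x. t - x) \<in> measurable (lebesgue_on ?R) (lebesgue_on S)"
    by (intro measurable_restrict_space2 measurable_restrict_space1 lebesgue_measurable_reflect)
      (auto simp: space_restrict_space)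
  show "distr (lebesgue_on ?R) (lebesgue_on S) (\<lambda>x. t - x) = lebesgue_on S"
  proof (rule measure_eqI)
    fix A assume "A \<in> sets (distr (lebesgue_on ?R) (lebesgue_on S) (\<lambda>x. t - x))"
    then have A: "A \<in> sets (lebesgue_on S)" by simp
    then have A': "A \<in> sets lebesgue" "A \<subseteq> S"
      using S by (auto simp: sets_restrict_space_iff)
    have "emeasure (distr (lebesgue_on ?R) (lebesgue_on S) (\<lambda>x. t - x)) A =
      emeasure (lebesgue_on ?R) ((\<lambda>x. t - x) -` A)"
      using A'(2) by (subst emeasure_distr[OF meas A]) (auto simp: space_restrict_space intro!: arg_cong2[where f=emeasure])
    also have "\<dots> = emeasure lebesgue ((\<lambda>x. t - x) -` A)"
      using R A'(2) by (intro emeasure_restrict_space) auto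
    also have "\<dots> = emeasure lebesgue A" using A'(1) by (rule emeasure_lebesgue_reflect)
    also have "\<dots> = emeasure (lebesgue_on S) A"
      using S A'(2) by (intro emeasure_restrict_space[symmetric]) auto
    finally show "emeasure (distr (lebesgue_on ?R) (lebesgue_on S) (\<lambda>x. t - x)) A = emeasure (lebesgue_on S) A" .
  qed simp
qed

lemma surj_on_lebesgue_on_reflect:
  "(\<lambda>x. t - x) ` space (lebesgue_on ((\<lambda>x. t - x) -` S)) = space (lebesgue_on S)" for t :: real
proof safe
  fix y assume "y \<in> space (lebesgue_on S)"
  then show "y \<in> (\<lambda>x. t - x) ` space (lebesgue_on ((\<lambda>x. t - x) -` S))"
    by (intro image_eqI[of _ _ "t - y"]) auto
qed auto

lemma strongly_measurable_reflect:
  fixes t :: real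
  assumes S: "S \<in> sets lebesgue" and f: "strongly_measurable (lebesgue_on S) f"
  shows "strongly_measurable (lebesgue_on ((\<lambda>x. t - x) -` S)) (\<lambda>x. f (t - x))"
proof (rule strongly_measurable_distr_compose[OF _ _ surj_on_lebesgue_on_reflect])
  show "strongly_measurable (distr (lebesgue_on ((\<lambda>x. t - x) -` S)) (lebesgue_on S) (\<lambda>x. t - x)) f"
    unfolding distr_lebesgue_on_reflect(1)[OF S] by (rule f)
qed (rule distr_lebesgue_on_reflect(2)[OF S])

lemma has_vector_bochner_integral_reflect_imp:
  fixes t :: real
  assumes S: "S \<in> sets lebesgue" and f: "has_vector_bochner_integral (lebesgue_on S) f I"
  shows "has_vector_bochner_integral (lebesgue_on ((\<lambda>x. t - x) -` S)) (\<lambda>x. f (t - x)) I"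
proof (rule has_vector_bochner_integral_distr[OF _ _ _ surj_on_lebesgue_on_reflect])
  show "has_vector_bochner_integral (distr (lebesgue_on ((\<lambda>x. t - x) -` S)) (lebesgue_on S) (\<lambda>x. t - x)) f I"
    unfolding distr_lebesgue_on_reflect(1)[OF S] by (rule f)
  show "complete_measure (distr (lebesgue_on ((\<lambda>x. t - x) -` S)) (lebesgue_on S) (\<lambda>x. t - x))"
    unfolding distr_lebesgue_on_reflect(1)[OF S] by (rule complete_measure_lebesgue_on[OF S])
qed (rule distr_lebesgue_on_reflect(2)[OF S])

text \<open>The reflection is an involution, so the converse is the same implication for the
  reflected set.\<close>

lemma has_vector_bochner_integral_reflect:
  fixes t :: real
  assumes S: "S \<in> sets lebesgue"
  shows "has_vector_bochner_integral (lebesgue_on ((\<lambda>x. t - x) -` S)) (\<lambda>x. f (t - x)) I \<longleftrightarrow>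
    has_vector_bochner_integral (lebesgue_on S) f I"
proof
  assume *: "has_vector_bochner_integral (lebesgue_on ((\<lambda>x. t - x) -` S)) (\<lambda>x. f (t - x)) I"
  have "(\<lambda>x. t - x) -` S \<in> sets lebesgue"
    using measurable_sets[OF lebesgue_measurable_reflect S] by simp
  from has_vector_bochner_integral_reflect_imp[OF this *, of t]
  show "has_vector_bochner_integral (lebesgue_on S) f I" by (simp add: vimage_def)
qed (rule has_vector_bochner_integral_reflect_imp[OF S])

section \<open>Hoelder's inequality\<close>

lemma ennreal_root_le_iff:
  assumes "0 < q" "0 \<le> B"
  shows "ennreal_root q x \<le> ennreal B \<longleftrightarrow> x \<le> ennreal (B powr q)"
proof (cases x)
  case (real y)
  have "y powr (1 / q) \<le> B \<longleftrightarrow> y \<le> B powr q"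
  proof
    assume "y powr (1 / q) \<le> B"
    then have "(y powr (1 / q)) powr q \<le> B powr q" using assms by (intro powr_mono2) auto
    then show "y \<le> B powr q" using assms real by (simp add: powr_powr)
  next
    assume "y \<le> B powr q"
    then have "y powr (1 / q) \<le> (B powr q) powr (1 / q)" using assms real by (intro powr_mono2) auto
    then show "y powr (1 / q) \<le> B" using assms by (simp add: powr_powr)
  qed
  then show ?thesis using real assms by (simp add: ennreal_root_def)
next
  case top
  then show ?thesis by (simp add: ennreal_root_def top_unique)
qed

text \<open>Power estimates are carried out on the right-hand side, where no root occurs.\<close>

lemma lp_norm_le_iff:
  assumes "0 < q" "0 \<le> B"
  shows "lp_norm (ennreal q) M f \<le> ennreal B \<longleftrightarrow> (\<integral>\<^sup>+x. ennreal (norm (f x) powr q) \<partial>M) \<le> ennreal (B powr q)"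
  using assms by (simp add: lp_norm_def ennreal_root_le_iff)

text \<open>Young's inequality for the three factors \<open>x\<close>, \<open>y\<close> and 1, the
  weight of 1 being what \<open>1 / q + 1 / \<rho>\<close> leaves. Two applications of the weighted
  mean inequality: \<open>x * y\<close> is \<open>?Z powr \<sigma>\<close>, which is averaged
  against 1 first; then \<open>?Z\<close> is bounded by the weighted mean of the two powers.\<close>

lemma young_three:
  fixes x y :: real
  assumes "0 < q" "0 < \<rho>" "1 / q + 1 / \<rho> \<le> 1" "0 \<le> x" "0 \<le> y"
  shows "x * y \<le> x powr q / q + y powr \<rho> / \<rho> + (1 - 1 / q - 1 / \<rho>)"
proof (cases "x = 0 \<or> y = 0")
  case False
  define \<sigma> where "\<sigma> = 1 / q + 1 / \<rho>"
  have \<sigma>: "0 < \<sigma>" "\<sigma> \<le> 1" using assms by (auto simp: \<sigma>_def intro: add_pos_pos)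
  let ?X = "x powr q" and ?Y = "y powr \<rho>"
  let ?Z = "?X powr (1 / q / \<sigma>) * ?Y powr (1 / \<rho> / \<sigma>)"
  have "?Z powr \<sigma> * 1 powr (1 - \<sigma>) \<le> \<sigma> * ?Z + (1 - \<sigma>) * 1"
    using \<sigma> False assms by (intro Youngs_inequality_0) auto
  moreover have "?Z powr \<sigma> = x * y"
    using \<sigma> False assms by (simp add: powr_mult powr_powr)
  moreover have "?Z \<le> (1 / q / \<sigma>) * ?X + (1 / \<rho> / \<sigma>) * ?Y"
  proof (rule Youngs_inequality_0)
    have "1 / q / \<sigma> + 1 / \<rho> / \<sigma> = (1 / q + 1 / \<rho>) / \<sigma>" by (simp only: add_divide_distrib)
    then show "1 / q / \<sigma> + 1 / \<rho> / \<sigma> = 1" using \<sigma> unfolding \<sigma>_def by simp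
  qed (use \<sigma> False assms in auto)
  then have "\<sigma> * ?Z \<le> \<sigma> * ((1 / q / \<sigma>) * ?X + (1 / \<rho> / \<sigma>) * ?Y)"
    using \<sigma> by (intro mult_left_mono) auto
  moreover have "\<sigma> * ((1 / q / \<sigma>) * ?X + (1 / \<rho> / \<sigma>) * ?Y) = ?X / q + ?Y / \<rho>"
    using \<sigma> by (simp add: distrib_left)
  ultimately show ?thesis by (simp add: \<sigma>_def)
qed (use assms in auto)

text \<open>On a space of measure at most one the exponents need only satisfy \<open>1/q + 1/\<rho> \<le> 1\<close>: the
  missing exponent is taken by the constant function one.\<close>

lemma nn_integral_mult_le_holder:
  fixes f :: "'a \<Rightarrow> 'b::real_normed_vector" and g :: "'a \<Rightarrow> 'c::real_normed_vector"
  assumes M: "emeasure M (space M) \<le> 1"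
    and [measurable]: "(\<lambda>x. norm (f x)) \<in> borel_measurable M" "(\<lambda>x. norm (g x)) \<in> borel_measurable M"
    and q: "0 < q" "0 < \<rho>" "1 / q + 1 / \<rho> \<le> 1" and pos: "0 < A" "0 < B"
    and f: "(\<integral>\<^sup>+x. ennreal (norm (f x) powr q) \<partial>M) \<le> ennreal (A powr q)"
    and g: "(\<integral>\<^sup>+x. ennreal (norm (g x) powr \<rho>) \<partial>M) \<le> ennreal (B powr \<rho>)"
  shows "(\<integral>\<^sup>+x. ennreal (norm (f x) * norm (g x)) \<partial>M) \<le> ennreal (A * B)"
proof -
  \<comment> \<open>Coefficients of Young's inequality for \<open>norm (f x) / A\<close> and
    \<open>norm (g x) / B\<close> after multiplication by \<open>A * B\<close>. The three integrated
    terms contribute \<open>A * B\<close> times \<open>1 / q\<close>, \<open>1 / \<rho>\<close> and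
    the remaining weight, altogether \<open>A * B\<close>.\<close>
  define a where "a = A * B / (q * A powr q)"
  define b where "b = A * B / (\<rho> * B powr \<rho>)"
  define d where "d = A * B * (1 - 1 / q - 1 / \<rho>)"
  have nn: "0 \<le> a" "0 \<le> b" "0 \<le> d" using q pos by (auto simp: a_def b_def d_def)
  have "norm (f x) * norm (g x) \<le> a * norm (f x) powr q + b * norm (g x) powr \<rho> + d" for x
  proof -
    have "norm (f x) / A * (norm (g x) / B) \<le>
      (norm (f x) / A) powr q / q + (norm (g x) / B) powr \<rho> / \<rho> + (1 - 1 / q - 1 / \<rho>)"
      using q pos by (intro young_three) auto
    then have "A * B * (norm (f x) / A * (norm (g x) / B)) \<le>
      A * B * ((norm (f x) / A) powr q / q + (norm (g x) / B) powr \<rho> / \<rho> + (1 - 1 / q - 1 / \<rho>))"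
      using pos by (intro mult_left_mono) auto
    also have "\<dots> = a * norm (f x) powr q + b * norm (g x) powr \<rho> + d"
      using pos q by (simp add: a_def b_def d_def powr_divide distrib_left right_diff_distrib mult.commute)
    finally show ?thesis using pos by (simp add: field_simps)
  qed
  then have "(\<integral>\<^sup>+x. ennreal (norm (f x) * norm (g x)) \<partial>M) \<le>
    (\<integral>\<^sup>+x. ennreal a * ennreal (norm (f x) powr q) + ennreal b * ennreal (norm (g x) powr \<rho>) + ennreal d \<partial>M)"
    using nn by (intro nn_integral_mono) (auto simp: ennreal_leI simp flip: ennreal_mult ennreal_plus)
  also have "\<dots> = ennreal a * (\<integral>\<^sup>+x. ennreal (norm (f x) powr q) \<partial>M) +
    ennreal b * (\<integral>\<^sup>+x. ennreal (norm (g x) powr \<rho>) \<partial>M) + ennreal d * emeasure M (space M)"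
    by (simp add: nn_integral_add nn_integral_cmult)
  also have "\<dots> \<le> ennreal a * ennreal (A powr q) + ennreal b * ennreal (B powr \<rho>) + ennreal d * 1"
    using f g M by (intro add_mono mult_left_mono) auto
  also have "\<dots> = ennreal (a * A powr q + b * B powr \<rho> + d)"
    using nn by (simp flip: ennreal_mult ennreal_plus)
  also have "a * A powr q + b * B powr \<rho> + d = A * B"
    using pos q by (simp add: a_def b_def d_def field_simps)
  finally show ?thesis .
qed

lemma nn_integral_mult_le_lp_norm:
  fixes f :: "'a \<Rightarrow> 'b::real_normed_vector" and g :: "'a \<Rightarrow> 'c::real_normed_vector"
  assumes M: "emeasure M (space M) \<le> 1"
    and meas: "(\<lambda>x. norm (f x)) \<in> borel_measurable M" "(\<lambda>x. norm (g x)) \<in> borel_measurable M"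
    and \<rho>: "1 < \<rho>" and q': "q' = \<infinity> \<or> (\<exists>q>0. q' = ennreal q \<and> 1 / q + 1 / \<rho> \<le> 1)"
    and f: "lp_norm q' M f < \<infinity>" and g: "lp_norm (ennreal \<rho>) M g \<le> ennreal B" and B: "0 \<le> B"
  shows "(\<integral>\<^sup>+x. ennreal (norm (f x) * norm (g x)) \<partial>M) \<le> lp_norm q' M f * ennreal B"
proof -
  obtain A where A: "0 \<le> A" "lp_norm q' M f = ennreal A"
    using f by (cases "lp_norm q' M f") auto
  \<comment> \<open>The inequality to be applied divides by its bounds, which may vanish here; both
    are enlarged by \<open>e\<close>, which tends to 0 at the end.\<close>
  have "(\<integral>\<^sup>+x. ennreal (norm (f x) * norm (g x)) \<partial>M) \<le> ennreal ((A + e) * (B + e))" if "0 < e" for e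
  proof -
    have "\<exists>q>0. 1 / q + 1 / \<rho> \<le> 1 \<and> (\<integral>\<^sup>+x. ennreal (norm (f x) powr q) \<partial>M) \<le> ennreal ((A + e) powr q)"
      using q'
    proof
      assume inf: "q' = \<infinity>"
      \<comment> \<open>An essential bound is turned into a bound with the exponent conjugate to
        \<open>\<rho>\<close>, which is possible as the measure of the space is at most one.\<close>
      let ?q = "\<rho> / (\<rho> - 1)"
      have "AE x in M. ennreal (norm (f x)) \<le> ennreal A"
        using esssup_AE[where M=M and f="\<lambda>x. ennreal (norm (f x))"] A(2) inf by (simp add: lp_norm_def)
      then have "(\<integral>\<^sup>+x. ennreal (norm (f x) powr ?q) \<partial>M) \<le> (\<integral>\<^sup>+x. ennreal ((A + e) powr ?q) \<partial>M)"
        using A(1) that \<rho> by (intro nn_integral_mono_AE) (auto elim!: eventually_mono intro!: ennreal_leI powr_mono2)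
      also have "\<dots> \<le> ennreal ((A + e) powr ?q) * 1"
        using M by (simp add: mult_left_mono del: mult_1_right)
      finally show ?thesis using \<rho> by (intro exI[of _ ?q]) (auto simp: field_simps)
    next
      assume "\<exists>q>0. q' = ennreal q \<and> 1 / q + 1 / \<rho> \<le> 1"
      then obtain q where q: "0 < q" "q' = ennreal q" "1 / q + 1 / \<rho> \<le> 1" by blast
      have "lp_norm (ennreal q) M f \<le> ennreal (A + e)" using A q that by (simp add: ennreal_leI)
      then show ?thesis using q A(1) that by (intro exI[of _ q]) (simp add: lp_norm_le_iff del: ennreal_plus)
    qed
    then obtain q where q: "0 < q" "1 / q + 1 / \<rho> \<le> 1"
      "(\<integral>\<^sup>+x. ennreal (norm (f x) powr q) \<partial>M) \<le> ennreal ((A + e) powr q)" by blast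
    have "lp_norm (ennreal \<rho>) M g \<le> ennreal (B + e)"
      using g that B by (meson ennreal_leI le_add_same_cancel1 less_imp_le order_trans)
    then have "(\<integral>\<^sup>+x. ennreal (norm (g x) powr \<rho>) \<partial>M) \<le> ennreal ((B + e) powr \<rho>)"
      using \<rho> B that by (simp add: lp_norm_le_iff del: ennreal_plus)
    then show ?thesis
      using q A(1) B \<rho> that by (intro nn_integral_mult_le_holder[OF M meas, of q \<rho>]) auto
  qed
  then have ev: "\<forall>\<^sub>F e in at_right 0. (\<integral>\<^sup>+x. ennreal (norm (f x) * norm (g x)) \<partial>M) \<le> ennreal ((A + e) * (B + e))"
    unfolding eventually_at_right_field by (intro exI[of _ 1]) auto
  have "((\<lambda>e. ennreal ((A + e) * (B + e))) \<longlongrightarrow> ennreal ((A + 0) * (B + 0))) (at_right 0)"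
    by (intro tendsto_ennrealI tendsto_intros)
  from tendsto_lowerbound[OF this ev] have "(\<integral>\<^sup>+x. ennreal (norm (f x) * norm (g x)) \<partial>M) \<le> ennreal (A * B)"
    by simp
  then show ?thesis using A B by (simp add: ennreal_mult)
qed

section \<open>Convolution with functions of bounded Stepanov norm\<close>

text \<open>As \<open>s\<close> increases through \<open>{a..a + 1}\<close>, \<open>t - s\<close>
  runs backwards through the unit interval starting at \<open>t - a - 1\<close>. The window
  \<open>{0..1}\<close> is the one used in \<open>APS\<close>.\<close>

lemma lp_norm_reflect_unit_interval:
  fixes g :: "real \<Rightarrow> 'b::real_normed_vector"
  assumes g: "(\<lambda>x. norm (g x)) \<in> borel_measurable lebesgue" and \<rho>: "0 < \<rho>"
  shows "lp_norm (ennreal \<rho>) (lebesgue_on {a..a + 1}) (\<lambda>s. g (t - s)) =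
    lp_norm (ennreal \<rho>) (lebesgue_on {0..1}) (\<lambda>s. g (t - a - 1 + s))"
proof -
  have "(\<lambda>s. norm (g (t - a - 1 + s))) \<in> borel_measurable lebesgue"
    using measurable_compose[OF lebesgue_measurable_translate g] .
  then have "(\<lambda>s. ennreal (norm (g (t - a - 1 + s)) powr \<rho>)) \<in> borel_measurable lebesgue"
    by measurable
  then have "(\<lambda>s. ennreal (norm (g (t - a - 1 + s)) powr \<rho>) * indicator {0..1} s) \<in> borel_measurable lebesgue"
    by (intro borel_measurable_times_ennreal borel_measurable_indicator) auto
  then have "(\<integral>\<^sup>+s. ennreal (norm (g (t - a - 1 + s)) powr \<rho>) * indicator {0..1} s \<partial>lebesgue) =
    (\<integral>\<^sup>+s. ennreal (norm (g (t - a - 1 + (a + 1 - s))) powr \<rho>) * indicator {0..1} (a + 1 - s) \<partial>lebesgue)"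
    using nn_integral_real_affine_lebesgue[of "\<lambda>s. ennreal (norm (g (t - a - 1 + s)) powr \<rho>) * indicator {0..1} s" "-1" "a + 1"]
    by simp
  also have "\<dots> = (\<integral>\<^sup>+s. ennreal (norm (g (t - s)) powr \<rho>) * indicator {a..a + 1} s \<partial>lebesgue)"
    by (intro nn_integral_cong) (auto simp: indicator_def)
  finally show ?thesis
    using \<rho> by (simp add: lp_norm_def nn_integral_restrict_space)
qed

text \<open>The bound \<open>B\<close> holds on every unit window, hence uniformly in
  \<open>k\<close> and \<open>t\<close>, and factors out of the sum; decay is demanded of
  \<open>T\<close> alone.\<close>

lemma nn_integral_convolution_le:
  fixes T :: "real \<Rightarrow> 'b::real_normed_vector" and g :: "real \<Rightarrow> 'c::real_normed_vector"
  assumes T: "(\<lambda>s. norm (T s)) \<in> borel_measurable (lebesgue_on {0..})"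
    and g: "(\<lambda>x. norm (g x)) \<in> borel_measurable lebesgue"
    and \<rho>: "1 < \<rho>" and q': "q' = \<infinity> \<or> (\<exists>q>0. q' = ennreal q \<and> 1 / q + 1 / \<rho> \<le> 1)"
    and fin: "(\<Sum>k. lp_norm q' (lebesgue_on {real k..real k + 1}) T) < \<infinity>"
    and B: "\<And>a. lp_norm (ennreal \<rho>) (lebesgue_on {0..1}) (\<lambda>s. g (a + s)) \<le> ennreal B" "0 \<le> B"
  shows "(\<integral>\<^sup>+s. ennreal (norm (T s) * norm (g (t - s))) \<partial>lebesgue_on {0<..}) \<le>
    (\<Sum>k. lp_norm q' (lebesgue_on {real k..real k + 1}) T) * ennreal B"
proof -
  let ?F = "\<lambda>s. ennreal (norm (T s) * norm (g (t - s)))"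
  let ?L = "\<lambda>k::nat. lp_norm q' (lebesgue_on {real k..real k + 1}) T"
  have gt: "(\<lambda>s. norm (g (t - s))) \<in> borel_measurable lebesgue"
    using measurable_compose[OF lebesgue_measurable_reflect g] .
  have T_k: "(\<lambda>s. norm (T s)) \<in> borel_measurable (lebesgue_on {real k..real k + 1})" for k
    using measurable_restrict_mono[OF T, of "{real k..real k + 1}"] by (auto simp: subset_eq)
  have gt_k: "(\<lambda>s. norm (g (t - s))) \<in> borel_measurable (lebesgue_on {real k..real k + 1})" for k
    using gt by (rule measurable_restrict_space1)
  have meas: "(\<lambda>s. ?F s * indicator {real k..real k + 1} s) \<in> borel_measurable lebesgue" for k
  proof -
    have "?F \<in> borel_measurable (lebesgue_on {real k..real k + 1})"
      using T_k[of k] gt_k[of k] by measurable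
    then show ?thesis by (subst (asm) borel_measurable_restrict_space_iff_ennreal) auto
  qed
  have fin_k: "?L k < \<infinity>" for k
  proof -
    have "?L k \<le> (\<Sum>k. ?L k)" using sum_le_suminf[of ?L "{k}"] by simp
    then show ?thesis using fin by (rule le_less_trans)
  qed
  have piece: "(\<integral>\<^sup>+s. ?F s * indicator {real k..real k + 1} s \<partial>lebesgue) \<le> ?L k * ennreal B" for k
  proof -
    have "lp_norm (ennreal \<rho>) (lebesgue_on {real k..real k + 1}) (\<lambda>s. g (t - s)) \<le> ennreal B"
      using B(1) \<rho> by (subst lp_norm_reflect_unit_interval[OF g]) auto
    then have "(\<integral>\<^sup>+s. ?F s \<partial>lebesgue_on {real k..real k + 1}) \<le> ?L k * ennreal B"
      using T_k gt_k \<rho> q' fin_k B(2)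
      by (intro nn_integral_mult_le_lp_norm[where \<rho>=\<rho>]) (auto simp: emeasure_restrict_space)
    then show ?thesis by (simp add: nn_integral_restrict_space)
  qed
  have "(\<integral>\<^sup>+s. ?F s \<partial>lebesgue_on {0<..}) = (\<integral>\<^sup>+s. ?F s * indicator {0<..} s \<partial>lebesgue)"
    by (simp add: nn_integral_restrict_space)
  \<comment> \<open>Neighbouring closed intervals share an end point, so the indicators add up to at
    least one rather than exactly one.\<close>
  also have "\<dots> \<le> (\<integral>\<^sup>+s. (\<Sum>k. ?F s * indicator {real k..real k + 1} s) \<partial>lebesgue)"
  proof (rule nn_integral_mono)
    fix s :: real
    show "?F s * indicator {0<..} s \<le> (\<Sum>k. ?F s * indicator {real k..real k + 1} s)"
    proof (cases "0 < s")
      case True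
      define k where "k = nat \<lfloor>s\<rfloor>"
      have k: "s \<in> {real k..real k + 1}" using True unfolding k_def by auto
      have "?F s * indicator {0<..} s = ?F s * indicator {real k..real k + 1} s"
        using k True by simp
      also have "\<dots> \<le> (\<Sum>k. ?F s * indicator {real k..real k + 1} s)"
        using sum_le_suminf[OF summableI, of "{k}" "\<lambda>k. ?F s * indicator {real k..real k + 1} s"]
        by (simp del: sum_mult_indicator ennreal_suminf_cmult)
      finally show ?thesis .
    qed simp
  qed
  also have "\<dots> = (\<Sum>k. \<integral>\<^sup>+s. ?F s * indicator {real k..real k + 1} s \<partial>lebesgue)"
    by (intro nn_integral_suminf meas)
  also have "\<dots> \<le> (\<Sum>k. ?L k * ennreal B)" by (intro suminf_le piece) auto
  also have "\<dots> = (\<Sum>k. ?L k) * ennreal B" by (rule ennreal_suminf_multc)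
  finally show ?thesis .
qed

section \<open>The degenerate semigroup\<close>

lemma mlo_inverse_shift_iff:
  "x \<in> mlo_inverse (mlo_shift z \<A>) y \<longleftrightarrow> (\<exists>a\<in>\<A> x. y = z *\<^sub>C x - a)"
  by (auto simp: mlo_inverse_def mlo_shift_def)

lemma resolvent_works:
  assumes "z \<in> resolvent_set \<A>"
  shows "mlo_inverse (mlo_shift z \<A>) y = {blinfun_apply (resolvent \<A> z) y}"
proof -
  obtain R :: "'a \<Rightarrow>\<^sub>L 'a" where R: "\<forall>y. mlo_inverse (mlo_shift z \<A>) y = {blinfun_apply R y}"
    using assms unfolding resolvent_set_def by blast
  have "resolvent \<A> z = R"
    unfolding resolvent_def
  proof (rule the_equality)
    fix S assume "\<forall>y. mlo_inverse (mlo_shift z \<A>) y = {blinfun_apply S y}"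
    then show "S = R" using R by (intro blinfun_eqI) (metis singleton_inject)
  qed (rule R)
  then show ?thesis using R by simp
qed

text \<open>Read off from the graph: \<open>x = R(w) y\<close> means \<open>y = w x - a\<close> for
  some \<open>a\<close> in \<open>\<A> x\<close>, and the same \<open>a\<close> exhibits
  \<open>x\<close> as the image under \<open>R(z)\<close> of \<open>z x - a = y + (z - w) x\<close>.
  Multivaluedness does no harm because a single \<open>a\<close> serves both points.\<close>

lemma resolvent_identity:
  assumes "z \<in> resolvent_set \<A>" "w \<in> resolvent_set \<A>"
  shows "blinfun_apply (resolvent \<A> w) y =
    blinfun_apply (resolvent \<A> z) (y + (z - w) *\<^sub>C blinfun_apply (resolvent \<A> w) y)"
proof -
  let ?x = "blinfun_apply (resolvent \<A> w) y"
  have "?x \<in> mlo_inverse (mlo_shift w \<A>) y" using resolvent_works[OF assms(2), of y] by simp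
  then obtain a where a: "a \<in> \<A> ?x" "y = w *\<^sub>C ?x - a" unfolding mlo_inverse_shift_iff by blast
  have "y + (z - w) *\<^sub>C ?x = (w + (z - w)) *\<^sub>C ?x - a"
    unfolding scaleC_add_left using a(2) by (simp add: algebra_simps)
  then have "?x \<in> mlo_inverse (mlo_shift z \<A>) (y + (z - w) *\<^sub>C ?x)"
    unfolding mlo_inverse_shift_iff using a(1) by auto
  then show ?thesis using resolvent_works[OF assms(1)] by auto
qed

lemma norm_resolvent_diff_le:
  assumes "z \<in> resolvent_set \<A>" "w \<in> resolvent_set \<A>"
  shows "norm (resolvent \<A> w - resolvent \<A> z) \<le>
    norm (resolvent \<A> z) * norm (resolvent \<A> w) * cmod (z - w)"
proof (rule norm_blinfun_bound)
  fix y
  let ?R = "\<lambda>z. blinfun_apply (resolvent \<A> z)"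
  have "?R w y - ?R z y = ?R z ((z - w) *\<^sub>C ?R w y)"
    by (subst resolvent_identity[OF assms]) (simp add: blinfun.add_right)
  then have "norm (blinfun_apply (resolvent \<A> w - resolvent \<A> z) y) = norm (?R z ((z - w) *\<^sub>C ?R w y))"
    by (simp add: blinfun.diff_left)
  also have "\<dots> \<le> norm (resolvent \<A> z) * (cmod (z - w) * (norm (resolvent \<A> w) * norm y))"
    by (rule order_trans[OF norm_blinfun])
      (auto simp: norm_scaleC intro!: mult_left_mono norm_blinfun)
  finally show "norm (blinfun_apply (resolvent \<A> w - resolvent \<A> z) y) \<le>
    norm (resolvent \<A> z) * norm (resolvent \<A> w) * cmod (z - w) * norm y" by (simp add: mult_ac)
qed (auto intro!: mult_nonneg_nonneg)

lemma bounded_bilinear_scaleC: "bounded_bilinear (scaleC :: complex \<Rightarrow> 'a \<Rightarrow> 'a::complex_normed_vector)"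
proof
  fix r :: real and z :: complex and x :: 'a
  show "(r *\<^sub>R z) *\<^sub>C x = r *\<^sub>R z *\<^sub>C x"
    by (simp add: scaleR_conv_of_real flip: scaleC_scaleC scaleC_of_real)
  show "z *\<^sub>C r *\<^sub>R x = r *\<^sub>R z *\<^sub>C x"
    by (simp add: scaleC_scaleC mult.commute flip: scaleC_of_real)
  show "\<exists>K. \<forall>z (x::'a). norm (z *\<^sub>C x) \<le> norm z * norm x * K"
    by (rule exI[of _ 1]) (simp add: norm_scaleC)
qed (auto simp: scaleC_add_left scaleC_add_right)

lemma Gamma_curve_in_Psi: "Gamma_curve c \<eta> \<in> Psi c"
  by (simp add: Gamma_curve_def Psi_def)

lemma continuous_on_Gamma_curve: "continuous_on S (Gamma_curve c)"
  unfolding Gamma_curve_def Complex_eq by (intro continuous_intros)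

section \<open>Convergence of the contour integral\<close>

lemma nn_integral_exp_abs_less_top:
  assumes "0 < (a::real)"
  shows "(\<integral>\<^sup>+x. ennreal (exp (- a * \<bar>x\<bar>)) \<partial>lebesgue) < \<infinity>"
proof -
  have "((\<lambda>x. - exp (- a * x) / a) \<longlongrightarrow> 0) at_top" using assms by real_asymp
  then have half: "(\<integral>\<^sup>+x. ennreal (exp (- a * x)) * indicator {0..} x \<partial>lborel) = ennreal (0 - (- exp (- a * 0) / a))"
    using assms by (intro nn_integral_FTC_atLeast) (auto intro!: derivative_eq_intros)
  have half': "(\<integral>\<^sup>+x. ennreal (exp (- a * - x)) * indicator {0..} (- x) \<partial>lborel) =
    (\<integral>\<^sup>+x. ennreal (exp (- a * x)) * indicator {0..} x \<partial>lborel)"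
    using nn_integral_real_affine[of "\<lambda>x. ennreal (exp (- a * x)) * indicator {0..} x" "-1" 0] by simp
  have "(\<integral>\<^sup>+x. ennreal (exp (- a * \<bar>x\<bar>)) \<partial>lebesgue) = (\<integral>\<^sup>+x. ennreal (exp (- a * \<bar>x\<bar>)) \<partial>lborel)"
    by (intro nn_integral_completion)
  also have "\<dots> \<le> (\<integral>\<^sup>+x. ennreal (exp (- a * x)) * indicator {0..} x +
      ennreal (exp (- a * - x)) * indicator {0..} (- x) \<partial>lborel)"
    by (intro nn_integral_mono) (auto simp: indicator_def)
  also have "\<dots> = (\<integral>\<^sup>+x. ennreal (exp (- a * x)) * indicator {0..} x \<partial>lborel) +
      (\<integral>\<^sup>+x. ennreal (exp (- a * - x)) * indicator {0..} (- x) \<partial>lborel)"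
    by (intro nn_integral_add) measurable
  also have "\<dots> < \<infinity>" unfolding half' half by simp
  finally show ?thesis .
qed

definition semigroup_integrand ::
    "('a::complex_normed_vector \<Rightarrow> 'a set) \<Rightarrow> real \<Rightarrow> real \<Rightarrow> real \<Rightarrow> 'a \<Rightarrow>\<^sub>L 'a" where
  "semigroup_integrand \<A> c t = (\<lambda>\<eta>.
    (exp (Gamma_curve c \<eta> * complex_of_real t) * Complex (- c * sgn \<eta>) 1) *\<^sub>C resolvent \<A> (Gamma_curve c \<eta>))"

context
  fixes \<A> :: "'a::complex_normed_vector \<Rightarrow> 'a set" and c M\<^sub>0 \<beta> :: real
  assumes P: "condition_P \<A> c M\<^sub>0 \<beta>"
begin

lemma Gamma_curve_in_resolvent_set: "Gamma_curve c \<eta> \<in> resolvent_set \<A>"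
  using P Gamma_curve_in_Psi unfolding condition_P_def by blast

text \<open>For \<open>t\<close> bounded away from 0 the exponential makes the contour integral
  converge, so a uniform bound for the resolvent along the curve is enough.\<close>

lemma norm_resolvent_Gamma_le: "norm (resolvent \<A> (Gamma_curve c \<eta>)) \<le> M\<^sub>0"
proof -
  let ?z = "Gamma_curve c \<eta>"
  have "norm (resolvent \<A> ?z) \<le> M\<^sub>0 * (1 + cmod ?z) powr (- \<beta>)"
    using P Gamma_curve_in_Psi unfolding condition_P_def by blast
  also have "\<dots> \<le> M\<^sub>0 * (1 + cmod ?z) powr 0"
    using P unfolding condition_P_def by (intro mult_left_mono powr_mono) auto
  also have "\<dots> = M\<^sub>0" by (simp add: add_nonneg_eq_0_iff)
  finally show ?thesis .
qed

lemma continuous_on_resolvent_Gamma: "continuous_on UNIV (\<lambda>\<eta>. resolvent \<A> (Gamma_curve c \<eta>))"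
proof (rule continuous_at_imp_continuous_on, rule ballI, unfold isCont_def, rule Lim_null[THEN iffD2])
  fix \<eta> :: real
  let ?R = "\<lambda>\<eta>. resolvent \<A> (Gamma_curve c \<eta>)"
  have G: "Gamma_curve c \<midarrow>\<eta>\<rightarrow> Gamma_curve c \<eta>"
    using continuous_on_Gamma_curve[of UNIV c] by (simp add: continuous_on_eq_continuous_at isCont_def)
  have "((\<lambda>x. M\<^sub>0 * M\<^sub>0 * cmod (Gamma_curve c \<eta> - Gamma_curve c x)) \<longlongrightarrow>
      M\<^sub>0 * M\<^sub>0 * cmod (Gamma_curve c \<eta> - Gamma_curve c \<eta>)) (at \<eta>)"
    by (intro tendsto_intros G)
  then have lim: "((\<lambda>x. M\<^sub>0 * M\<^sub>0 * cmod (Gamma_curve c \<eta> - Gamma_curve c x)) \<longlongrightarrow> 0) (at \<eta>)"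
    by simp
  show "((\<lambda>x. ?R x - ?R \<eta>) \<longlongrightarrow> 0) (at \<eta>)"
  proof (rule Lim_null_comparison[OF always_eventually lim], rule allI)
    fix x
    have "norm (?R x - ?R \<eta>) \<le> norm (?R \<eta>) * norm (?R x) * cmod (Gamma_curve c \<eta> - Gamma_curve c x)"
      by (intro norm_resolvent_diff_le Gamma_curve_in_resolvent_set)
    also have "\<dots> \<le> M\<^sub>0 * M\<^sub>0 * cmod (Gamma_curve c \<eta> - Gamma_curve c x)"
      using norm_resolvent_Gamma_le P unfolding condition_P_def by (intro mult_right_mono mult_mono) auto
    finally show "norm (?R x - ?R \<eta>) \<le> M\<^sub>0 * M\<^sub>0 * cmod (Gamma_curve c \<eta> - Gamma_curve c x)" .
  qed
qed

text \<open>The derivative of the curve jumps at 0, so the integrand need not be continuous. Its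
  scalar factor is a Borel function into a second countable space, its operator factor is
  continuous, and multiplication is jointly continuous.\<close>

lemma strongly_measurable_semigroup_integrand: "strongly_measurable lebesgue (semigroup_integrand \<A> c t)"
  unfolding semigroup_integrand_def
proof (rule strongly_measurable_compose2[where p=scaleC])
  show "continuous_on UNIV (\<lambda>z. fst z *\<^sub>C snd z :: 'a \<Rightarrow>\<^sub>L 'a)"
    by (intro bounded_bilinear.continuous_on[OF bounded_bilinear_scaleC] continuous_intros)
  show "strongly_measurable lebesgue (\<lambda>\<eta>. resolvent \<A> (Gamma_curve c \<eta>))"
    using strongly_measurable_continuous_on[OF _ continuous_on_resolvent_Gamma] by (simp add: lebesgue_on_UNIV_eq)
  have "(\<lambda>\<eta>. exp (Gamma_curve c \<eta> * complex_of_real t)) \<in> borel_measurable borel"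
    by (intro borel_measurable_continuous_onI continuous_intros continuous_on_Gamma_curve)
  moreover have "(\<lambda>\<eta>. Complex (- c * sgn \<eta>) 1) \<in> borel_measurable borel"
    unfolding Complex_eq by measurable
  ultimately have "(\<lambda>\<eta>. exp (Gamma_curve c \<eta> * complex_of_real t) * Complex (- c * sgn \<eta>) 1) \<in> borel_measurable lborel"
    by simp
  then show "strongly_measurable lebesgue (\<lambda>\<eta>. exp (Gamma_curve c \<eta> * complex_of_real t) * Complex (- c * sgn \<eta>) 1)"
    by (intro strongly_measurable_second_countable measurable_completion)
qed

text \<open>On the curve the exponent has real part
  \<open>- c * (\<bar>\<eta>\<bar> + 1) * t\<close>, which is at most
  \<open>- c * \<delta> * \<bar>\<eta>\<bar>\<close>; and \<open>c + 1\<close> bounds the derivative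
  of the curve. The majorant is common to all \<open>t \<ge> \<delta>\<close>, as dominated
  convergence requires.\<close>

lemma norm_semigroup_integrand_le:
  assumes "0 \<le> \<delta>" "\<delta> \<le> t"
  shows "norm (semigroup_integrand \<A> c t \<eta>) \<le> (c + 1) * M\<^sub>0 * exp (- (c * \<delta>) * \<bar>\<eta>\<bar>)"
proof -
  have c: "0 < c" "0 < M\<^sub>0" using P by (auto simp: condition_P_def)
  have 1: "cmod (exp (Gamma_curve c \<eta> * complex_of_real t)) \<le> exp (- (c * \<delta>) * \<bar>\<eta>\<bar>)"
  proof -
    have "c * \<delta> * \<bar>\<eta>\<bar> \<le> c * t * (\<bar>\<eta>\<bar> + 1)"
      using c assms by (intro mult_mono) auto
    then show ?thesis by (simp add: Gamma_curve_def mult_ac)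
  qed
  have "cmod (Complex (- c * sgn \<eta>) 1) \<le> \<bar>- c * sgn \<eta>\<bar> + \<bar>1\<bar>"
    using cmod_le[of "Complex (- c * sgn \<eta>) 1"] by simp
  also have "\<dots> \<le> c + 1" using c by (simp add: abs_mult abs_sgn_eq)
  finally have 2: "cmod (Complex (- c * sgn \<eta>) 1) \<le> c + 1" .
  have "norm (semigroup_integrand \<A> c t \<eta>) = cmod (exp (Gamma_curve c \<eta> * complex_of_real t)) *
      cmod (Complex (- c * sgn \<eta>) 1) * norm (resolvent \<A> (Gamma_curve c \<eta>))"
    by (simp add: semigroup_integrand_def norm_scaleC norm_mult)
  also have "\<dots> \<le> exp (- (c * \<delta>) * \<bar>\<eta>\<bar>) * (c + 1) * M\<^sub>0"
    using 1 2 c norm_resolvent_Gamma_le by (intro mult_mono) auto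
  finally show ?thesis by (simp add: mult_ac)
qed

lemma nn_integral_semigroup_dominant:
  assumes "0 < \<delta>"
  shows "(\<integral>\<^sup>+\<eta>. ennreal (C * exp (- (c * \<delta>) * \<bar>\<eta>\<bar>)) \<partial>lebesgue) < \<infinity>"
proof -
  have "0 < c * \<delta>" using P assms by (simp add: condition_P_def)
  from nn_integral_exp_abs_less_top[OF this] have "ennreal C * (\<integral>\<^sup>+\<eta>. ennreal (exp (- (c * \<delta>) * \<bar>\<eta>\<bar>)) \<partial>lebesgue) < \<infinity>"
    by (simp add: ennreal_mult_less_top)
  moreover have "(\<lambda>\<eta>. ennreal (exp (- (c * \<delta>) * \<bar>\<eta>\<bar>))) \<in> borel_measurable lebesgue"
    by (rule measurable_completion) measurable
  ultimately show ?thesis by (simp only: ennreal_mult'' exp_ge_zero nn_integral_cmult)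
qed

end

text \<open>Dominated convergence in operator norm. The majorant is integrable only for
  \<open>\<delta> > 0\<close>, so continuity is proved on each \<open>{\<delta><..}\<close>, and
  \<open>\<delta> = t / 2\<close> is used at the point \<open>t\<close>.\<close>

lemma continuous_on_degenerate_semigroup:
  fixes \<A> :: "'a::complex_banach \<Rightarrow> 'a set"
  assumes P: "condition_P \<A> c M\<^sub>0 \<beta>"
  shows "continuous_on {0<..} (degenerate_semigroup \<A> c)"
proof -
  let ?K = "semigroup_integrand \<A> c"
  let ?k = "1 / (2 * complex_of_real pi * \<i>)"
  have cm: "complete_measure (lebesgue :: real measure)" by (rule completion.complete_measure_axioms)
  have int: "has_vector_bochner_integral lebesgue (?K t) (vector_bochner_integral lebesgue (?K t))" if "0 < t" for t
  proof (rule has_vector_bochner_integral_exists[OF cm strongly_measurable_semigroup_integrand[OF P]])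
    have "(\<integral>\<^sup>+\<eta>. ennreal (norm (?K t \<eta>)) \<partial>lebesgue) \<le>
      (\<integral>\<^sup>+\<eta>. ennreal ((c + 1) * M\<^sub>0 * exp (- (c * t) * \<bar>\<eta>\<bar>)) \<partial>lebesgue)"
      using that by (intro nn_integral_mono ennreal_leI norm_semigroup_integrand_le[OF P]) auto
    also have "\<dots> < \<infinity>" using that by (rule nn_integral_semigroup_dominant[OF P])
    finally show "(\<integral>\<^sup>+\<eta>. ennreal (norm (?K t \<eta>)) \<partial>lebesgue) < \<infinity>" .
  qed
  have eq: "degenerate_semigroup \<A> c = (\<lambda>t. ?k *\<^sub>C vector_bochner_integral lebesgue (?K t))"
    by (simp add: degenerate_semigroup_def semigroup_integrand_def fun_eq_iff)
  have cont: "continuous_on {\<delta><..} (\<lambda>t. vector_bochner_integral lebesgue (?K t))" if \<delta>: "0 < \<delta>" for \<delta>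
    unfolding continuous_on_sequentially
  proof (intro allI ballI impI, elim conjE)
    fix x :: "nat \<Rightarrow> real" and a
    assume a: "a \<in> {\<delta><..}" and x: "\<forall>n. x n \<in> {\<delta><..}" and lim: "x \<longlonglongrightarrow> a"
    let ?I = "\<lambda>t. vector_bochner_integral lebesgue (?K t)"
    have "(\<lambda>n. \<integral>\<^sup>+\<eta>. ennreal (norm (?K (x n) \<eta> - ?K a \<eta>)) \<partial>lebesgue) \<longlonglongrightarrow> (\<integral>\<^sup>+(\<eta>::real). 0 \<partial>lebesgue)"
    proof (rule nn_integral_dominated_convergence[where w="\<lambda>\<eta>. ennreal (2 * ((c + 1) * M\<^sub>0) * exp (- (c * \<delta>) * \<bar>\<eta>\<bar>))"])
      show "(\<lambda>\<eta>. ennreal (norm (?K (x n) \<eta> - ?K a \<eta>))) \<in> borel_measurable lebesgue" for n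
        using borel_measurable_norm_diff_strongly[OF cm strongly_measurable_semigroup_integrand[OF P]
            strongly_measurable_semigroup_integrand[OF P]] by measurable
      show "(\<lambda>\<eta>. ennreal (2 * ((c + 1) * M\<^sub>0) * exp (- (c * \<delta>) * \<bar>\<eta>\<bar>))) \<in> borel_measurable lebesgue"
        by (rule measurable_completion) measurable
      show "(\<integral>\<^sup>+\<eta>. ennreal (2 * ((c + 1) * M\<^sub>0) * exp (- (c * \<delta>) * \<bar>\<eta>\<bar>)) \<partial>lebesgue) < \<infinity>"
        using \<delta> by (rule nn_integral_semigroup_dominant[OF P])
      show "AE \<eta> in lebesgue. ennreal (norm (?K (x n) \<eta> - ?K a \<eta>)) \<le>
        ennreal (2 * ((c + 1) * M\<^sub>0) * exp (- (c * \<delta>) * \<bar>\<eta>\<bar>))" for n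
      proof (intro AE_I2 ennreal_leI)
        fix \<eta>
        have "norm (?K (x n) \<eta> - ?K a \<eta>) \<le> norm (?K (x n) \<eta>) + norm (?K a \<eta>)" by (rule norm_triangle_ineq4)
        also have "\<dots> \<le> (c + 1) * M\<^sub>0 * exp (- (c * \<delta>) * \<bar>\<eta>\<bar>) + (c + 1) * M\<^sub>0 * exp (- (c * \<delta>) * \<bar>\<eta>\<bar>)"
          using \<delta> a x by (intro add_mono norm_semigroup_integrand_le[OF P]) (auto intro: less_imp_le)
        finally show "norm (?K (x n) \<eta> - ?K a \<eta>) \<le> 2 * ((c + 1) * M\<^sub>0) * exp (- (c * \<delta>) * \<bar>\<eta>\<bar>)"
          by (simp only: mult_2 distrib_right)
      qed
      show "AE \<eta> in lebesgue. (\<lambda>n. ennreal (norm (?K (x n) \<eta> - ?K a \<eta>))) \<longlonglongrightarrow> 0"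
      proof (rule AE_I2)
        fix \<eta> :: real
        have "(\<lambda>n. norm (?K (x n) \<eta> - ?K a \<eta>)) \<longlonglongrightarrow> norm (?K a \<eta> - ?K a \<eta>)"
          unfolding semigroup_integrand_def
          by (intro tendsto_intros bounded_bilinear.tendsto[OF bounded_bilinear_scaleC] lim)
        then have "(\<lambda>n. norm (?K (x n) \<eta> - ?K a \<eta>)) \<longlonglongrightarrow> 0" by simp
        from tendsto_ennrealI[OF this] show "(\<lambda>n. ennreal (norm (?K (x n) \<eta> - ?K a \<eta>))) \<longlonglongrightarrow> 0" by simp
      qed
    qed simp
    then have lim0: "(\<lambda>n. \<integral>\<^sup>+\<eta>. ennreal (norm (?K (x n) \<eta> - ?K a \<eta>)) \<partial>lebesgue) \<longlonglongrightarrow> 0" by simp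
    have "(\<lambda>n. ennreal (norm (?I (x n) - ?I a))) \<longlonglongrightarrow> 0"
    proof (rule tendsto_sandwich[OF _ _ tendsto_const lim0])
      show "\<forall>\<^sub>F n in sequentially. ennreal (norm (?I (x n) - ?I a)) \<le>
        (\<integral>\<^sup>+\<eta>. ennreal (norm (?K (x n) \<eta> - ?K a \<eta>)) \<partial>lebesgue)"
      proof (intro always_eventually allI)
        fix n
        have "0 < x n" "0 < a" using x a \<delta> by (auto dest: spec[of _ n])
        then show "ennreal (norm (?I (x n) - ?I a)) \<le>
            (\<integral>\<^sup>+\<eta>. ennreal (norm (?K (x n) \<eta> - ?K a \<eta>)) \<partial>lebesgue)"
          by (intro has_vector_bochner_integral_diff_norm_le[OF cm] int)
      qed
    qed simp
    then have "(\<lambda>n. norm (?I (x n) - ?I a)) \<longlonglongrightarrow> 0"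
      by (subst (asm) ennreal_0[symmetric], subst (asm) tendsto_ennreal_iff) auto
    then show "((\<lambda>t. ?I t) \<circ> x) \<longlonglongrightarrow> ?I a"
      unfolding comp_def by (subst Lim_null) (rule tendsto_norm_zero_cancel)
  qed
  have "isCont (degenerate_semigroup \<A> c) t" if "0 < t" for t
  proof -
    have "continuous_on {t / 2<..} (degenerate_semigroup \<A> c)"
      unfolding eq using that
      by (intro bounded_bilinear.continuous_on[OF bounded_bilinear_scaleC] continuous_on_const cont) auto
    then show ?thesis using that by (simp add: continuous_on_eq_continuous_at)
  qed
  then show ?thesis by (intro continuous_at_imp_continuous_on) auto
qed

section \<open>Almost periodicity\<close>

text \<open>\<open>E \<epsilon> a b\<close> reads ``\<open>a\<close> and \<open>b\<close> are at distance at most \<open>\<epsilon>\<close>'' for a quasimetric with triangle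
  constant \<open>C\<close>.\<close>

lemma almost_periodic_imp_uniformly_continuous_aux:
  fixes E :: "real \<Rightarrow> real \<Rightarrow> real \<Rightarrow> bool"
  assumes C: "0 < C"
    and sym: "\<And>\<epsilon> a b. E \<epsilon> a b \<Longrightarrow> E \<epsilon> b a"
    and tri: "\<And>\<epsilon> a b c. 0 < \<epsilon> \<Longrightarrow> E \<epsilon> a b \<Longrightarrow> E \<epsilon> b c \<Longrightarrow> E (C * \<epsilon>) a c"
    and refl: "\<And>\<epsilon> a. 0 < \<epsilon> \<Longrightarrow> E \<epsilon> a a"
    and cont: "\<And>\<epsilon> t. 0 < \<epsilon> \<Longrightarrow> \<exists>\<delta>>0. \<forall>s. \<bar>s - t\<bar> < \<delta> \<longrightarrow> E \<epsilon> s t"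
    and ap: "\<And>\<epsilon>. 0 < \<epsilon> \<Longrightarrow> \<exists>l>0. \<forall>a. \<exists>\<tau>\<in>{a..a + l}. \<forall>t. E \<epsilon> (t + \<tau>) t"
    and \<epsilon>: "0 < \<epsilon>"
  shows "\<exists>\<delta>>0. \<forall>s t. \<bar>s - t\<bar> < \<delta> \<longrightarrow> E \<epsilon> s t"
proof -
  \<comment> \<open>The path from \<open>s\<close> over \<open>s + \<tau>\<close> and
    \<open>t + \<tau>\<close> to \<open>t\<close> leads through three nested uses of
    \<open>tri\<close>, each costing a factor \<open>C\<close>.\<close>
  define e where "e = \<epsilon> / (C * C * C)"
  have e: "0 < e" "C * (C * (C * e)) = \<epsilon>" using \<epsilon> C by (auto simp: e_def)
  obtain l where l: "l > 0" "\<And>a. \<exists>\<tau>\<in>{a..a + l}. \<forall>t. E e (t + \<tau>) t" using ap[OF e(1)] by blast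
  obtain d where d: "\<And>t. 0 < d t" "\<And>s t. \<bar>s - t\<bar> < d t \<Longrightarrow> E e s t"
    using cont[OF e(1)] by metis
  have "compact {0..l}" by simp
  moreover have "{0..l} \<subseteq> \<Union>(range (\<lambda>t. ball t (d t)))" using d(1) centre_in_ball by blast
  \<comment> \<open>A Lebesgue number of the cover: \<open>t\<close> is moved into
    \<open>{0..l}\<close> below, but \<open>s\<close> may end up outside, so a whole ball around the
    moved point must lie in one member.\<close>
  ultimately obtain \<delta> where \<delta>: "0 < \<delta>" "\<forall>x\<in>{0..l}. \<exists>G\<in>range (\<lambda>t. ball t (d t)). ball x \<delta> \<subseteq> G"
    by (rule Heine_Borel_lemma) auto
  have "E \<epsilon> s t" if st: "\<bar>s - t\<bar> < \<delta>" for s t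
  proof -
    obtain \<tau> where \<tau>: "\<tau> \<in> {-t..-t + l}" "\<And>t. E e (t + \<tau>) t" using l(2)[of "-t"] by blast
    have "t + \<tau> \<in> {0..l}" using \<tau>(1) by auto
    then obtain a where "ball (t + \<tau>) \<delta> \<subseteq> ball a (d a)" using \<delta>(2) by blast
    moreover have "t + \<tau> \<in> ball (t + \<tau>) \<delta>" "s + \<tau> \<in> ball (t + \<tau>) \<delta>"
      using \<delta>(1) st by (auto simp: dist_real_def)
    ultimately have "t + \<tau> \<in> ball a (d a)" "s + \<tau> \<in> ball a (d a)" by blast+
    then have "E e (t + \<tau>) a" "E e (s + \<tau>) a" using d(2) by (auto simp: dist_real_def abs_minus_commute)
    then have 1: "E (C * e) (s + \<tau>) (t + \<tau>)" using tri[OF e(1)] sym by blast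
    have Ce: "0 < C * e" "0 < C * (C * e)" using C e by auto
    \<comment> \<open>\<open>tri\<close> wants the same tolerance on both sides, and monotonicity of
      \<open>E\<close> in its first argument is not assumed; combining with reflexivity weakens a
      bound by the factor \<open>C\<close>.\<close>
    have mono: "E (C * x) a b" if "E x a b" "0 < x" for x a b
      using tri[OF that(2,1) refl[OF that(2)]] .
    have "E (C * (C * e)) s (t + \<tau>)"
      by (rule tri[OF Ce(1) mono[OF sym[OF \<tau>(2)] e(1)] 1])
    then have "E (C * (C * (C * e))) s t"
      by (rule tri[OF Ce(2) _ mono[OF mono[OF \<tau>(2) e(1)] Ce(1)]])
    then show ?thesis using e(2) by simp
  qed
  then show ?thesis using \<delta>(1) by blast
qed

lemma almost_periodic_uniformly_continuous:
  assumes u: "almost_periodic u" and \<epsilon>: "0 < \<epsilon>"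
  shows "\<exists>\<delta>>0. \<forall>s t. \<bar>s - t\<bar> < \<delta> \<longrightarrow> norm (u s - u t) \<le> \<epsilon>"
proof (rule almost_periodic_imp_uniformly_continuous_aux[where C=2 and E="\<lambda>\<epsilon> s t. norm (u s - u t) \<le> \<epsilon>"])
  show "norm (u a - u c) \<le> 2 * \<epsilon>" if "norm (u a - u b) \<le> \<epsilon>" "norm (u b - u c) \<le> \<epsilon>" for \<epsilon> a b c
    using norm_diff_triangle_le[OF that] by simp
  show "\<exists>\<delta>>0. \<forall>s. \<bar>s - t\<bar> < \<delta> \<longrightarrow> norm (u s - u t) \<le> \<epsilon>" if "0 < \<epsilon>" for \<epsilon> t
  proof -
    have "isCont u t" using u by (simp add: almost_periodic_def continuous_on_eq_continuous_at)
    then have "\<exists>\<delta>>0. \<forall>s. dist s t < \<delta> \<longrightarrow> dist (u s) (u t) < \<epsilon>"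
      using that unfolding continuous_at_eps_delta by simp
    then show ?thesis unfolding dist_real_def dist_norm by (meson less_imp_le)
  qed
  show "\<exists>l>0. \<forall>a. \<exists>\<tau>\<in>{a..a + l}. \<forall>t. norm (u (t + \<tau>) - u t) \<le> \<epsilon>" if "0 < \<epsilon>" for \<epsilon>
    using u that by (simp add: almost_periodic_def)
qed (use \<epsilon> in \<open>auto simp: norm_minus_commute\<close>)

text \<open>One direction of Bochner's characterisation. An almost period from
  \<open>{a - l..a}\<close> moves \<open>a\<close> into \<open>{0..l}\<close>, where a finite net
  suffices by uniform continuity.\<close>

lemma almost_periodic_translates_totally_bounded:
  assumes u: "almost_periodic u" and \<epsilon>: "0 < \<epsilon>"
  obtains A where "finite A" "\<And>a. \<exists>b\<in>A. \<forall>t. norm (u (t + a) - u (t + b)) \<le> \<epsilon>"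
proof -
  obtain l where l: "l > 0" "\<And>a. \<exists>\<tau>\<in>{a..a + l}. \<forall>t. norm (u (t + \<tau>) - u t) \<le> \<epsilon> / 2"
    using u \<epsilon> unfolding almost_periodic_def by (meson half_gt_zero)
  obtain \<delta> where \<delta>: "\<delta> > 0" "\<And>s t. \<bar>s - t\<bar> < \<delta> \<Longrightarrow> norm (u s - u t) \<le> \<epsilon> / 2"
    using almost_periodic_uniformly_continuous[OF u] \<epsilon> by (meson half_gt_zero)
  obtain A where A: "finite A" "{0..l} \<subseteq> (\<Union>x\<in>A. ball x \<delta>)"
    using \<delta>(1) compact_eq_totally_bounded[of "{0..l}"] compact_Icc[of 0 l] by meson
  show ?thesis
  proof (rule that[OF A(1)])
    fix a
    obtain \<tau> where \<tau>: "\<tau> \<in> {a - l..a - l + l}" "\<And>t. norm (u (t + \<tau>) - u t) \<le> \<epsilon> / 2" using l(2) by blast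
    then have "a - \<tau> \<in> {0..l}" by auto
    then obtain b where b: "b \<in> A" "a - \<tau> \<in> ball b \<delta>" using A(2) by blast
    have "norm (u (t + a) - u (t + b)) \<le> \<epsilon>" for t
    proof -
      have "norm (u (t + a) - u (t + a - \<tau>)) \<le> \<epsilon> / 2" using \<tau>(2)[of "t + a - \<tau>"] by simp
      moreover have "norm (u (t + a - \<tau>) - u (t + b)) \<le> \<epsilon> / 2" using b(2) by (intro \<delta>(2)) (simp add: dist_real_def algebra_simps abs_minus_commute)
      ultimately show ?thesis using norm_diff_triangle_le by fastforce
    qed
    then show "\<exists>b\<in>A. \<forall>t. norm (u (t + a) - u (t + b)) \<le> \<epsilon>" using b(1) by blast
  qed
qed

lemma almost_periodic_range_net:
  assumes "almost_periodic u" "0 < \<epsilon>"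
  obtains K where "finite K" "K \<subseteq> range u" "\<And>a. \<exists>y\<in>K. norm (u a - y) \<le> \<epsilon>"
proof -
  obtain A where A: "finite A" "\<And>a. \<exists>b\<in>A. \<forall>t. norm (u (t + a) - u (t + b)) \<le> \<epsilon>"
    by (rule almost_periodic_translates_totally_bounded[OF assms]) (rule that)
  have "\<exists>y\<in>u ` A. norm (u a - y) \<le> \<epsilon>" for a
  proof -
    obtain b where "b \<in> A" "\<forall>t. norm (u (t + a) - u (t + b)) \<le> \<epsilon>" using A(2)[of a] by (rule bexE)
    then show ?thesis by (intro bexI[of _ "u b"]) (auto dest: spec[of _ 0])
  qed
  then show ?thesis using A(1) by (intro that[of "u ` A"]) auto
qed

lemma almost_periodic_bounded:
  assumes "almost_periodic u"
  shows "bounded (range u)"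
proof -
  obtain K where K: "finite K" "K \<subseteq> range u" "\<And>a. \<exists>y\<in>K. norm (u a - y) \<le> 1"
    by (rule almost_periodic_range_net[OF assms zero_less_one]) (rule that)
  then obtain B where B: "\<And>y. y \<in> K \<Longrightarrow> norm y \<le> B"
    using finite_imp_bounded[OF K(1)] unfolding bounded_iff by blast
  have "norm (u a) \<le> B + 1" for a
  proof -
    obtain y where "y \<in> K" "norm (u a - y) \<le> 1" using K(3) by blast
    then show ?thesis using B[of y] norm_triangle_sub[of "u a" y] by simp
  qed
  then show ?thesis unfolding bounded_iff by blast
qed

text \<open>Only one of the two families of almost periods has to come from a uniformly continuous
  function: the almost periods \<open>\<sigma> a\<close> of the other one are sorted into finitely many classes
  according to the translate of \<open>u\<close> they produce, and differences within a class work for both.\<close>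

lemma almost_periodic_common_periods:
  fixes Q :: "real \<Rightarrow> real \<Rightarrow> bool"
  assumes u: "almost_periodic u" and C: "0 < C"
    and Q: "\<And>\<epsilon>. 0 < \<epsilon> \<Longrightarrow> \<exists>l>0. \<forall>a. \<exists>\<tau>\<in>{a..a + l}. Q \<epsilon> \<tau>"
    and Q_diff: "\<And>\<epsilon> a b. 0 < \<epsilon> \<Longrightarrow> Q \<epsilon> a \<Longrightarrow> Q \<epsilon> b \<Longrightarrow> Q (C * \<epsilon>) (a - b)"
    and pos: "0 < \<epsilon>" "0 < \<eta>"
  shows "\<exists>l>0. \<forall>a. \<exists>\<tau>\<in>{a..a + l}. (\<forall>t. norm (u (t + \<tau>) - u t) \<le> \<epsilon>) \<and> Q \<eta> \<tau>"
proof -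
  have e: "0 < \<eta> / C" using pos C by simp
  from Q[OF e] obtain l where l: "l > 0" "\<forall>a. \<exists>\<tau>\<in>{a..a + l}. Q (\<eta> / C) \<tau>" by blast
  then obtain \<sigma> where \<sigma>: "\<And>a. \<sigma> a \<in> {a..a + l}" "\<And>a. Q (\<eta> / C) (\<sigma> a)" by metis
  obtain A where A: "finite A" "\<And>a. \<exists>b\<in>A. \<forall>t. norm (u (t + a) - u (t + b)) \<le> \<epsilon> / 2"
    by (rule almost_periodic_translates_totally_bounded[OF u half_gt_zero[OF pos(1)]]) (rule that)
  define R where "R a b \<longleftrightarrow> (\<forall>t. norm (u (t + \<sigma> a) - u (t + b)) \<le> \<epsilon> / 2)" for a b
  \<comment> \<open>One representative shift for each class. For an empty class the choice is
    arbitrary; such a value only enters the bound \<open>L\<close>.\<close>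
  define \<rho> where "\<rho> b = \<sigma> (SOME a. R a b)" for b
  obtain L where L: "0 < L" "\<And>b. b \<in> A \<Longrightarrow> \<bar>\<rho> b\<bar> \<le> L"
    using finite_imp_bounded[OF finite_imageI[OF A(1), of \<rho>]] unfolding bounded_pos by auto
  \<comment> \<open>The first shift is taken from \<open>{a + L..a + L + l}\<close> and the
    representative has absolute value at most \<open>L\<close>, so the difference lies in
    \<open>{a..a + (2 * L + l)}\<close>.\<close>
  show ?thesis
  proof (intro exI[of _ "2 * L + l"] conjI allI)
    fix a
    obtain b where b: "b \<in> A" "R (a + L) b" using A(2)[of "\<sigma> (a + L)"] unfolding R_def by blast
    define a' where "a' = (SOME a. R a b)"
    have a': "R a' b" "\<rho> b = \<sigma> a'" unfolding a'_def \<rho>_def using b(2) by (auto intro: someI)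
    let ?\<tau> = "\<sigma> (a + L) - \<sigma> a'"
    have "?\<tau> \<in> {a..a + (2 * L + l)}"
      using L(2)[OF b(1)] \<sigma>(1)[of "a + L"] unfolding a'(2) by (auto simp: abs_le_iff)
    moreover have "norm (u (t + ?\<tau>) - u t) \<le> \<epsilon>" for t
    proof -
      have "norm (u (t - \<sigma> a' + \<sigma> (a + L)) - u (t - \<sigma> a' + b)) \<le> \<epsilon> / 2"
        "norm (u (t - \<sigma> a' + \<sigma> a') - u (t - \<sigma> a' + b)) \<le> \<epsilon> / 2"
        using b(2) a'(1) unfolding R_def by blast+
      then show ?thesis
        using norm_diff_triangle_le[of "u (t - \<sigma> a' + \<sigma> (a + L))" "u (t - \<sigma> a' + b)" "\<epsilon> / 2" "u t" "\<epsilon> / 2"]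
        by (simp add: norm_minus_commute algebra_simps)
    qed
    moreover have "Q \<eta> ?\<tau>"
      using Q_diff[OF e \<sigma>(2) \<sigma>(2), of "a + L" a'] C by simp
    ultimately show "\<exists>\<tau>\<in>{a..a + (2 * L + l)}. (\<forall>t. norm (u (t + \<tau>) - u t) \<le> \<epsilon>) \<and> Q \<eta> \<tau>" by blast
  qed (use L l in auto)
qed

section \<open>Constants and uniform limits\<close>

lemma almost_periodic_const: "almost_periodic (\<lambda>_. x)"
  unfolding almost_periodic_def
proof (intro conjI allI impI exI[of _ "1::real"])
  show "\<exists>\<tau>\<in>{a..a + 1}. \<forall>t::real. norm (x - x) \<le> \<epsilon>" if "0 < \<epsilon>" for \<epsilon> a :: real
    using that by (intro bexI[of _ a]) auto
qed auto

lemma almost_periodic_uniform_limit: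
  assumes u: "\<And>\<epsilon>. 0 < \<epsilon> \<Longrightarrow> \<exists>v. almost_periodic v \<and> (\<forall>t. norm (u t - v t) \<le> \<epsilon>)"
    and cont: "continuous_on UNIV u"
  shows "almost_periodic u"
  unfolding almost_periodic_def
proof (intro conjI cont allI impI)
  fix \<epsilon> :: real assume "0 < \<epsilon>"
  then obtain v where v: "almost_periodic v" "\<And>t. norm (u t - v t) \<le> \<epsilon> / 3"
    using u[of "\<epsilon> / 3"] by auto
  have "0 < \<epsilon> / 3" using \<open>0 < \<epsilon>\<close> by simp
  then obtain l where l: "l > 0" "\<And>a. \<exists>\<tau>\<in>{a..a + l}. \<forall>t. norm (v (t + \<tau>) - v t) \<le> \<epsilon> / 3"
    using v(1) unfolding almost_periodic_def by blast
  show "\<exists>l>0. \<forall>a. \<exists>\<tau>\<in>{a..a + l}. \<forall>t. norm (u (t + \<tau>) - u t) \<le> \<epsilon>"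
  proof (intro exI[of _ l] conjI allI l(1))
    fix a
    obtain \<tau> where \<tau>: "\<tau> \<in> {a..a + l}" "\<And>t. norm (v (t + \<tau>) - v t) \<le> \<epsilon> / 3" using l(2) by blast
    have "norm (u (t + \<tau>) - u t) \<le> \<epsilon>" for t
    proof -
      have "norm (u (t + \<tau>) - v t) \<le> \<epsilon> / 3 + \<epsilon> / 3"
        by (rule norm_diff_triangle_le[OF v(2) \<tau>(2)])
      then have "norm (u (t + \<tau>) - u t) \<le> \<epsilon> / 3 + \<epsilon> / 3 + \<epsilon> / 3"
        by (rule norm_diff_triangle_le) (use v(2)[of t] in \<open>simp add: norm_minus_commute\<close>)
      then show ?thesis by simp
    qed
    then show "\<exists>\<tau>\<in>{a..a + l}. \<forall>t. norm (u (t + \<tau>) - u t) \<le> \<epsilon>" using \<tau>(1) by blast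
  qed
qed

section \<open>Stepanov almost periodic functions\<close>

lemma lp_norm_minus_commute: "lp_norm q M (\<lambda>x. f x - g x) = lp_norm q M (\<lambda>x. g x - f x)"
  by (simp add: lp_norm_def norm_minus_commute)

lemma lp_norm_zero: "0 < q \<Longrightarrow> lp_norm (ennreal q) M (\<lambda>x. 0) = 0"
  by (simp add: lp_norm_def ennreal_root_def)

text \<open>A quasi-triangle inequality suffices, and it avoids Minkowski's inequality.\<close>

lemma lp_norm_quasi_triangle:
  assumes p: "1 \<le> p" and e: "0 < \<epsilon>"
    and [measurable]: "(\<lambda>x. norm (f x - g x)) \<in> borel_measurable M" "(\<lambda>x. norm (g x - h x)) \<in> borel_measurable M"
    and fg: "lp_norm (ennreal p) M (\<lambda>x. f x - g x) \<le> ennreal \<epsilon>"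
    and gh: "lp_norm (ennreal p) M (\<lambda>x. g x - h x) \<le> ennreal \<epsilon>"
  shows "lp_norm (ennreal p) M (\<lambda>x. f x - h x) \<le> ennreal (4 * \<epsilon>)"
proof -
  let ?J = "\<lambda>f. \<integral>\<^sup>+x. ennreal (norm (f x) powr p) \<partial>M"
  have "norm (f x - h x) powr p \<le> 2 powr p * norm (f x - g x) powr p + 2 powr p * norm (g x - h x) powr p" for x
  proof -
    let ?m = "max (norm (f x - g x)) (norm (g x - h x))"
    have "norm (f x - h x) \<le> norm (f x - g x) + norm (g x - h x)"
      by (rule norm_diff_triangle_ineq[of "f x" "g x" "g x" "h x", simplified]) 
    then have "norm (f x - h x) powr p \<le> (2 * ?m) powr p"
      using p by (intro powr_mono2) auto
    also have "\<dots> = 2 powr p * ?m powr p" by (simp add: powr_mult)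
    also have "\<dots> \<le> 2 powr p * (norm (f x - g x) powr p + norm (g x - h x) powr p)"
      by (intro mult_left_mono) (auto simp: max_def)
    finally show ?thesis by (simp add: distrib_left)
  qed
  then have "?J (\<lambda>x. f x - h x) \<le> (\<integral>\<^sup>+x. ennreal (2 powr p) * ennreal (norm (f x - g x) powr p) +
      ennreal (2 powr p) * ennreal (norm (g x - h x) powr p) \<partial>M)"
    by (intro nn_integral_mono) (simp add: ennreal_leI flip: ennreal_mult ennreal_plus)
  also have "\<dots> = ennreal (2 powr p) * ?J (\<lambda>x. f x - g x) + ennreal (2 powr p) * ?J (\<lambda>x. g x - h x)"
    by (simp add: nn_integral_add nn_integral_cmult)
  also have "\<dots> \<le> ennreal (2 powr p) * ennreal (\<epsilon> powr p) + ennreal (2 powr p) * ennreal (\<epsilon> powr p)"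
    using fg gh p e by (intro add_mono mult_left_mono) (auto simp: lp_norm_le_iff)
  also have "\<dots> = ennreal (2 * ((2 * \<epsilon>) powr p))"
    using e by (simp add: powr_mult flip: ennreal_mult ennreal_plus)
  \<comment> \<open>One factor 2 bounds the sum of two norms by twice their maximum. The other
    absorbs the two integrals, through \<open>2 \<le> 2 powr p\<close> for
    \<open>p \<ge> 1\<close>.\<close>
  also have "\<dots> \<le> ennreal ((4 * \<epsilon>) powr p)"
  proof (rule ennreal_leI)
    have "2 * ((2 * \<epsilon>) powr p) \<le> 2 powr p * ((2 * \<epsilon>) powr p)"
      using p powr_mono[of 1 p 2] by (intro mult_right_mono) auto
    also have "\<dots> = (4 * \<epsilon>) powr p" using e by (simp flip: powr_mult)
    finally show "2 * ((2 * \<epsilon>) powr p) \<le> (4 * \<epsilon>) powr p" .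
  qed
  finally show ?thesis using p e by (subst lp_norm_le_iff) auto
qed

lemma real_cover_unit_intervals: "\<Union>(range (\<lambda>n::int. {real_of_int n..real_of_int n + 1})) = UNIV"
proof -
  have "x \<in> {real_of_int \<lfloor>x\<rfloor>..real_of_int \<lfloor>x\<rfloor> + 1}" for x :: real
    by (simp add: less_imp_le)
  then show ?thesis by blast
qed

text \<open>\<open>APS\<close> speaks only of the windows \<open>f (t + s) x\<close> with
  \<open>s\<close> in \<open>{0..1}\<close>. Those starting at integers are moved back by two
  reflections and glued together.\<close>

lemma APS_strongly_measurable:
  assumes "f \<in> APS p"
  shows "strongly_measurable lebesgue (\<lambda>s. f s x)"
proof (rule strongly_measurable_lebesgue_cover[OF _ _ real_cover_unit_intervals])
  fix S :: "real set" assume "S \<in> range (\<lambda>n::int. {real_of_int n..real_of_int n + 1})"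
  then obtain n :: int where n: "S = {real_of_int n..real_of_int n + 1}" by blast
  have "strongly_measurable (lebesgue_on {0..1}) (\<lambda>s. f (real_of_int n + s) x)"
    using assms by (simp add: APS_def lp_space_def Let_def)
  moreover have "(\<lambda>s. 0 - s) -` {0..1} = {-1..0::real}" by auto
  ultimately have "strongly_measurable (lebesgue_on {-1..0}) (\<lambda>s. f (real_of_int n + (0 - s)) x)"
    using strongly_measurable_reflect[of "{0..1}" "\<lambda>s. f (real_of_int n + s) x" 0] by simp
  moreover have "(\<lambda>s. real_of_int n - s) -` {-1..0} = S" unfolding n by auto
  ultimately show "strongly_measurable (lebesgue_on S) (\<lambda>s. f s x)"
    using strongly_measurable_reflect[of "{-1..0}" "\<lambda>s. f (real_of_int n + (0 - s)) x" "real_of_int n"]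
    by simp
qed auto

lemma strongly_measurable_translate:
  fixes f :: "real \<Rightarrow> 'b::real_normed_vector"
  assumes "strongly_measurable lebesgue f"
  shows "strongly_measurable lebesgue (\<lambda>s. f (a + s))"
proof -
  have "strongly_measurable lebesgue (\<lambda>s. f (a - s))"
    using strongly_measurable_reflect[of UNIV f a] assms by (simp add: lebesgue_on_UNIV_eq)
  then show ?thesis
    using strongly_measurable_reflect[of UNIV "\<lambda>s. f (a - s)" 0] by (simp add: lebesgue_on_UNIV_eq)
qed

lemma lp_norm_unit_interval_translate:
  fixes g :: "real \<Rightarrow> 'b::real_normed_vector"
  assumes g: "(\<lambda>x. norm (g x)) \<in> borel_measurable lebesgue" and \<rho>: "0 < \<rho>"
  shows "lp_norm (ennreal \<rho>) (lebesgue_on {0..1}) (\<lambda>s. g (a + s)) = lp_norm (ennreal \<rho>) (lebesgue_on {a..a + 1}) g"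
proof -
  have "(\<lambda>x. norm (g (0 - x))) \<in> borel_measurable lebesgue"
    using measurable_compose[OF lebesgue_measurable_reflect g] .
  from lp_norm_reflect_unit_interval[OF this \<rho>, of a 0]
  have "lp_norm (ennreal \<rho>) (lebesgue_on {a..a + 1}) g =
    lp_norm (ennreal \<rho>) (lebesgue_on {0..0 + 1}) (\<lambda>s. g (a + 1 - s))" by (simp add: algebra_simps)
  also have "\<dots> = lp_norm (ennreal \<rho>) (lebesgue_on {0..1}) (\<lambda>s. g (a + s))"
    by (subst lp_norm_reflect_unit_interval[OF g \<rho>]) simp
  finally show ?thesis ..
qed

section \<open>The solution operator\<close>

text \<open>What the fixed point argument uses of the semigroup: measurability and summable local
  norms. The exponent condition names both \<open>p\<close> and \<open>r\<close> because
  \<open>T\<close> is convolved with the functions \<open>f _ x\<close>, controlled with exponent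
  \<open>p\<close>, and with \<open>L\<close>, controlled with exponent \<open>r\<close>. The reals
  \<open>m\<close> and \<open>S\<close> make the contraction constant \<open>m * S\<close> a real
  number.\<close>

locale stepanov_inclusion =
  fixes T :: "real \<Rightarrow> 'a::banach \<Rightarrow>\<^sub>L 'a" and f :: "real \<Rightarrow> 'a \<Rightarrow> 'a" and L :: "real \<Rightarrow> real"
    and p r m S :: real and q' :: ennreal
  assumes T: "strongly_measurable (lebesgue_on {0<..}) T"
    and p: "1 < p" and r: "1 < r"
    and q': "q' = \<infinity> \<or> (\<exists>q>0. q' = ennreal q \<and> 1 / q + 1 / p \<le> 1 \<and> 1 / q + 1 / r \<le> 1)"
    and f: "f \<in> APS p" and L: "L \<in> stepanov_space r"
    and lipschitz: "\<And>t x y. norm (f t x - f t y) \<le> L t * norm (x - y)"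
    and m: "(\<Sum>k. lp_norm q' (lebesgue_on {real k..real k + 1}) T) = ennreal m" "0 \<le> m"
    and S: "stepanov_norm r L = ennreal S" "0 \<le> S"
begin

lemma complete_lebesgue: "complete_measure (lebesgue :: real measure)"
  by (rule completion.complete_measure_axioms)

lemma borel_norm: "strongly_measurable lebesgue g \<Longrightarrow> (\<lambda>s. norm (g s)) \<in> borel_measurable lebesgue"
  for g :: "real \<Rightarrow> 'b::real_normed_vector"
  using strongly_measurable_imp_borel[OF complete_lebesgue] by measurable

lemma strongly_measurable_L: "strongly_measurable lebesgue L"
proof (rule strongly_measurable_lebesgue_cover[OF _ _ real_cover_unit_intervals])
  fix R :: "real set" assume "R \<in> range (\<lambda>n::int. {real_of_int n..real_of_int n + 1})"
  then obtain n :: int where "R = {real_of_int n..real_of_int n + 1}" by blast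
  then show "strongly_measurable (lebesgue_on R) L"
    using L by (simp add: stepanov_space_def lp_space_def)
qed auto

lemma lp_norm_L_le: "lp_norm (ennreal r) (lebesgue_on {0..1}) (\<lambda>s. L (a + s)) \<le> ennreal S"
  unfolding S(1)[symmetric] stepanov_norm_def
  using r by (subst lp_norm_unit_interval_translate[OF borel_norm[OF strongly_measurable_L]]) (auto intro: SUP_upper)

text \<open>\<open>L t\<close> is forced to be nonnegative only if the space contains a nonzero
  vector; the absolute value lets the bound be multiplied further in every case.\<close>

lemma lipschitz_abs: "norm (f t x - f t y) \<le> \<bar>L t\<bar> * norm (x - y)"
  by (rule order_trans[OF lipschitz]) (intro mult_right_mono, auto)

lemma continuous_on_f: "continuous_on UNIV (f t)"
proof (rule continuous_at_imp_continuous_on, rule ballI, unfold isCont_def, rule Lim_null[THEN iffD2])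
  fix x :: 'a
  have "((\<lambda>y. \<bar>L t\<bar> * norm (y - x)) \<longlongrightarrow> \<bar>L t\<bar> * norm (x - x)) (at x)" by (intro tendsto_intros)
  then have "((\<lambda>y. \<bar>L t\<bar> * norm (y - x)) \<longlongrightarrow> 0) (at x)" by simp
  then show "((\<lambda>y. f t y - f t x) \<longlongrightarrow> 0) (at x)"
    by (rule Lim_null_comparison[OF always_eventually[OF allI[OF lipschitz_abs]]])
qed

lemma strongly_measurable_f: "strongly_measurable lebesgue (\<lambda>s. f s x)"
  by (rule APS_strongly_measurable[OF f])

lemma strongly_measurable_superposition:
  assumes "continuous_on UNIV u"
  shows "strongly_measurable lebesgue (\<lambda>s. f s (u s))"
proof (rule strongly_measurable_Caratheodory[OF complete_lebesgue strongly_measurable_f continuous_on_f])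
  show "strongly_measurable lebesgue u"
    using strongly_measurable_continuous_on[OF _ assms] by (simp add: lebesgue_on_UNIV_eq)
qed

lemma strongly_measurable_reflected:
  fixes g :: "real \<Rightarrow> 'b::real_normed_vector"
  assumes "strongly_measurable lebesgue g"
  shows "strongly_measurable (lebesgue_on {0<..}) (\<lambda>s. g (t - s))"
proof -
  have "strongly_measurable lebesgue (\<lambda>s. g (t - s))"
    using strongly_measurable_reflect[of UNIV g t] assms by (simp add: lebesgue_on_UNIV_eq)
  then show ?thesis by (rule strongly_measurable_restrict_space) simp
qed

text \<open>The first interval in the sum defining \<open>m\<close> contains 0, where nothing is
  known about \<open>T\<close>. A single point is null, so \<open>T\<close> agrees almost everywhere
  on the closed half-line with its extension by 0.\<close>

lemma borel_norm_T: "(\<lambda>s. norm (T s)) \<in> borel_measurable (lebesgue_on {0..})"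
proof -
  define T' where "T' s = (if 0 < s then T s else 0)" for s
  have "strongly_measurable lebesgue T'"
  proof (rule strongly_measurable_lebesgue_cover[of "{{0<..}, {..0}}"])
    fix R :: "real set" assume "R \<in> {{0<..}, {..0}}"
    then consider "R = {0<..}" | "R = {..0}" by blast
    then show "strongly_measurable (lebesgue_on R) T'"
    proof cases
      case 1
      then show ?thesis
        using strongly_measurable_AE_cong[OF T AE_I2, of T'] by (simp add: T'_def)
    next
      case 2
      then show ?thesis
        using strongly_measurable_AE_cong[OF strongly_measurable_simple_function[OF simple_function_const[of _ 0]] AE_I2, of "lebesgue_on R" T']
        by (simp add: T'_def)
    qed
  qed auto
  then have "strongly_measurable (lebesgue_on {0..}) T'"
    by (rule strongly_measurable_restrict_space) simp
  moreover have "AE s in lebesgue_on {0..}. T' s = T s"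
  proof (subst AE_restrict_space_iff)
    have "AE s in lebesgue. s \<noteq> (0::real)"
      by (intro AE_completion AE_lborel_singleton)
    then show "AE s in lebesgue. s \<in> {0..} \<longrightarrow> T' s = T s"
      by eventually_elim (auto simp: T'_def)
  qed simp
  ultimately have "strongly_measurable (lebesgue_on {0..}) T"
    by (rule strongly_measurable_AE_cong)
  then have "T \<in> borel_measurable (lebesgue_on {0..})"
    by (rule strongly_measurable_imp_borel[OF complete_measure_lebesgue_on, rotated]) simp
  then show ?thesis by measurable
qed

section \<open>Convolution with the operator family\<close>

lemma convolution_le:
  fixes g :: "real \<Rightarrow> 'b::real_normed_vector"
  assumes g: "strongly_measurable lebesgue g" and \<rho>: "\<rho> = p \<or> \<rho> = r"
    and B: "\<And>a. lp_norm (ennreal \<rho>) (lebesgue_on {0..1}) (\<lambda>s. g (a + s)) \<le> ennreal B" "0 \<le> B"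
  shows "(\<integral>\<^sup>+s. ennreal (norm (T s) * norm (g (t - s))) \<partial>lebesgue_on {0<..}) \<le> ennreal (m * B)"
proof -
  have "1 < \<rho>" using \<rho> p r by auto
  moreover have "q' = \<infinity> \<or> (\<exists>q>0. q' = ennreal q \<and> 1 / q + 1 / \<rho> \<le> 1)" using q' \<rho> by auto
  ultimately show ?thesis
    using nn_integral_convolution_le[OF borel_norm_T borel_norm[OF g] _ _ _ B, of q' t] m B(2)
    by (simp add: ennreal_mult)
qed

lemma convolution_L_le: "(\<integral>\<^sup>+s. ennreal (norm (T s) * \<bar>L (t - s)\<bar>) \<partial>lebesgue_on {0<..}) \<le> ennreal (m * S)"
  using convolution_le[OF strongly_measurable_L _ lp_norm_L_le S(2)] by simp

lemma borel_convolution_integrand: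
  fixes g :: "real \<Rightarrow> 'b::real_normed_vector"
  assumes "strongly_measurable lebesgue g"
  shows "(\<lambda>s. ennreal (norm (T s) * norm (g (t - s)))) \<in> borel_measurable (lebesgue_on {0<..})"
proof -
  have [measurable]: "T \<in> borel_measurable (lebesgue_on {0<..})"
    "(\<lambda>s. g (t - s)) \<in> borel_measurable (lebesgue_on {0<..})"
    using T strongly_measurable_reflected[OF assms]
    by (auto intro!: strongly_measurable_imp_borel complete_measure_lebesgue_on)
  show ?thesis by measurable
qed

text \<open>Over the fixed half-line a change of \<open>t\<close> affects only the arguments of
  \<open>f\<close> and \<open>u\<close>, so values at different times can be compared under one
  integral.\<close>

definition solution_operator :: "(real \<Rightarrow> 'a) \<Rightarrow> real \<Rightarrow> 'a" where
  "solution_operator u t =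
    vector_bochner_integral (lebesgue_on {0<..}) (\<lambda>s. blinfun_apply (T s) (f (t - s) (u (t - s))))"

text \<open>Comparison with the value at 0 splits the integrand: \<open>f _ 0\<close> is bounded in
  the Stepanov norm with exponent \<open>p\<close>, and the remainder is at most the bound of
  \<open>u\<close> times \<open>\<bar>L\<bar>\<close>, controlled with exponent
  \<open>r\<close>.\<close>

lemma has_integral_solution_operator:
  assumes u: "continuous_on UNIV u" "bounded (range u)"
  shows "has_vector_bochner_integral (lebesgue_on {0<..})
    (\<lambda>s. blinfun_apply (T s) (f (t - s) (u (t - s)))) (solution_operator u t)"
  unfolding solution_operator_def
proof (rule has_vector_bochner_integral_exists)
  show "complete_measure (lebesgue_on {0::real<..})" by (rule complete_measure_lebesgue_on) simp
  show "strongly_measurable (lebesgue_on {0<..}) (\<lambda>s. blinfun_apply (T s) (f (t - s) (u (t - s))))"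
    by (intro strongly_measurable_blinfun_apply T strongly_measurable_reflected strongly_measurable_superposition u)
  obtain U where U: "\<And>s. norm (u s) \<le> U" "0 \<le> U"
    using u(2) unfolding bounded_pos by (auto intro: less_imp_le)
  obtain B where B: "\<And>t x. lp_norm (ennreal p) (lebesgue_on {0..1}) (\<lambda>s. f (t + s) x) \<le> ennreal B"
    using f by (auto simp: APS_def Let_def)
  \<comment> \<open>The definition of \<open>APS\<close> admits a negative \<open>B\<close>, which
    \<open>ennreal\<close> sends to 0; \<open>convolution_le\<close> asks for a nonnegative
    bound.\<close>
  have B': "lp_norm (ennreal p) (lebesgue_on {0..1}) (\<lambda>s. f (t + s) x) \<le> ennreal (max 0 B)" for t x
    by (rule order_trans[OF B ennreal_leI]) simp
  have "(\<integral>\<^sup>+s. ennreal (norm (blinfun_apply (T s) (f (t - s) (u (t - s))))) \<partial>lebesgue_on {0<..}) \<le>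
    (\<integral>\<^sup>+s. ennreal (norm (T s) * norm (f (t - s) 0)) + ennreal U * ennreal (norm (T s) * norm (L (t - s))) \<partial>lebesgue_on {0<..})"
  proof (rule nn_integral_mono)
    fix s
    have "norm (f (t - s) (u (t - s))) \<le> norm (f (t - s) 0) + \<bar>L (t - s)\<bar> * norm (u (t - s))"
      using norm_triangle_sub[of "f (t - s) (u (t - s))" "f (t - s) 0"] lipschitz_abs[of "t - s" "u (t - s)" 0] by simp
    also have "\<dots> \<le> norm (f (t - s) 0) + \<bar>L (t - s)\<bar> * U" using U by (intro add_left_mono mult_left_mono) auto
    finally have "norm (blinfun_apply (T s) (f (t - s) (u (t - s)))) \<le> norm (T s) * (norm (f (t - s) 0) + \<bar>L (t - s)\<bar> * U)"
      by (rule order_trans[OF norm_blinfun mult_left_mono]) simp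
    also have "\<dots> = norm (T s) * norm (f (t - s) 0) + U * (norm (T s) * norm (L (t - s)))"
      by (simp add: algebra_simps)
    finally show "ennreal (norm (blinfun_apply (T s) (f (t - s) (u (t - s))))) \<le>
      ennreal (norm (T s) * norm (f (t - s) 0)) + ennreal U * ennreal (norm (T s) * norm (L (t - s)))"
      using U(2) by (simp add: ennreal_leI flip: ennreal_mult ennreal_plus)
  qed
  also have "\<dots> = (\<integral>\<^sup>+s. ennreal (norm (T s) * norm (f (t - s) 0)) \<partial>lebesgue_on {0<..}) +
      ennreal U * (\<integral>\<^sup>+s. ennreal (norm (T s) * norm (L (t - s))) \<partial>lebesgue_on {0<..})"
    using borel_convolution_integrand[OF strongly_measurable_f[of 0]] borel_convolution_integrand[OF strongly_measurable_L]
    by (simp add: nn_integral_add nn_integral_cmult)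
  also have "\<dots> \<le> ennreal (m * max 0 B) + ennreal U * ennreal (m * S)"
    using convolution_le[OF strongly_measurable_f _ B'] convolution_L_le by (intro add_mono mult_left_mono) auto
  also have "\<dots> < \<infinity>" by (simp add: ennreal_mult_less_top)
  finally show "(\<integral>\<^sup>+s. ennreal (norm (blinfun_apply (T s) (f (t - s) (u (t - s))))) \<partial>lebesgue_on {0<..}) < \<infinity>" .
qed

text \<open>After reflection both sides concern the same integral. It exists for every bounded
  continuous \<open>u\<close>, so uniqueness of its value settles both directions.\<close>

lemma mild_solution_iff_fixed_point:
  assumes u: "continuous_on UNIV u" "bounded (range u)"
  shows "mild_solution T f u \<longleftrightarrow> solution_operator u = u"
proof -
  have "has_vector_bochner_integral (lebesgue_on {..<t}) (\<lambda>s. blinfun_apply (T (t - s)) (f s (u s))) (u t) \<longleftrightarrow>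
    solution_operator u t = u t" for t
  proof -
    have "(\<lambda>s. t - s) -` {..<t} = {0<..}" by auto
    then have "has_vector_bochner_integral (lebesgue_on {..<t}) (\<lambda>s. blinfun_apply (T (t - s)) (f s (u s))) (u t) \<longleftrightarrow>
      has_vector_bochner_integral (lebesgue_on {0<..}) (\<lambda>s. blinfun_apply (T s) (f (t - s) (u (t - s)))) (u t)"
      using has_vector_bochner_integral_reflect[of "{..<t}" t "\<lambda>s. blinfun_apply (T (t - s)) (f s (u s))" "u t"]
      by simp
    also have "\<dots> \<longleftrightarrow> solution_operator u t = u t"
    proof
      have "complete_measure (lebesgue_on {0::real<..})" by (rule complete_measure_lebesgue_on) simp
      then show "solution_operator u t = u t"
        if "has_vector_bochner_integral (lebesgue_on {0<..}) (\<lambda>s. blinfun_apply (T s) (f (t - s) (u (t - s)))) (u t)"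
        using has_integral_solution_operator[OF u] that by (rule has_vector_bochner_integral_unique)
    qed (metis has_integral_solution_operator[OF u])
    finally show ?thesis .
  qed
  then show ?thesis using u(1) by (auto simp: mild_solution_def fun_eq_iff)
qed

text \<open>Two functions and two times at once: \<open>t = t'\<close> leads to the contraction
  estimate, \<open>u = v\<close> to the estimate for shifts.\<close>

lemma solution_operator_diff_le:
  assumes u: "continuous_on UNIV u" "bounded (range u)" and v: "continuous_on UNIV v" "bounded (range v)"
  shows "ennreal (norm (solution_operator u t - solution_operator v t')) \<le>
    (\<integral>\<^sup>+s. ennreal (norm (T s) * norm (f (t - s) (u (t - s)) - f (t' - s) (v (t' - s)))) \<partial>lebesgue_on {0<..})"
proof -
  have "ennreal (norm (solution_operator u t - solution_operator v t')) \<le>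
    (\<integral>\<^sup>+s. ennreal (norm (blinfun_apply (T s) (f (t - s) (u (t - s))) - blinfun_apply (T s) (f (t' - s) (v (t' - s))))) \<partial>lebesgue_on {0<..})"
    by (intro has_vector_bochner_integral_diff_norm_le has_integral_solution_operator u v complete_measure_lebesgue_on) simp
  also have "\<dots> \<le> (\<integral>\<^sup>+s. ennreal (norm (T s) * norm (f (t - s) (u (t - s)) - f (t' - s) (v (t' - s)))) \<partial>lebesgue_on {0<..})"
    by (intro nn_integral_mono ennreal_leI) (simp add: norm_blinfun flip: blinfun.diff_right)
  finally show ?thesis .
qed

lemma solution_operator_contraction:
  assumes u: "continuous_on UNIV u" "bounded (range u)" and v: "continuous_on UNIV v" "bounded (range v)"
    and D: "\<And>s. norm (u s - v s) \<le> D"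
  shows "norm (solution_operator u t - solution_operator v t) \<le> m * S * D"
proof -
  have D0: "0 \<le> D" using D[of 0] norm_ge_zero order_trans by blast
  have "ennreal (norm (solution_operator u t - solution_operator v t)) \<le>
    (\<integral>\<^sup>+s. ennreal D * ennreal (norm (T s) * norm (L (t - s))) \<partial>lebesgue_on {0<..})"
  proof (rule order_trans[OF solution_operator_diff_le[OF u v] nn_integral_mono])
    fix s
    have "norm (f (t - s) (u (t - s)) - f (t - s) (v (t - s))) \<le> \<bar>L (t - s)\<bar> * D"
      by (rule order_trans[OF lipschitz_abs]) (intro mult_left_mono D, simp)
    then have "norm (T s) * norm (f (t - s) (u (t - s)) - f (t - s) (v (t - s))) \<le> norm (T s) * (\<bar>L (t - s)\<bar> * D)"
      by (rule mult_left_mono) simp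
    then show "ennreal (norm (T s) * norm (f (t - s) (u (t - s)) - f (t - s) (v (t - s)))) \<le>
      ennreal D * ennreal (norm (T s) * norm (L (t - s)))"
      using D0 by (simp add: ennreal_leI mult_ac flip: ennreal_mult)
  qed
  also have "\<dots> = ennreal D * (\<integral>\<^sup>+s. ennreal (norm (T s) * norm (L (t - s))) \<partial>lebesgue_on {0<..})"
    by (intro nn_integral_cmult borel_convolution_integrand strongly_measurable_L)
  also have "\<dots> \<le> ennreal D * ennreal (m * S)" using convolution_L_le by (intro mult_left_mono) auto
  also have "\<dots> = ennreal (m * S * D)" using D0 m S by (simp add: mult_ac flip: ennreal_mult)
  finally show ?thesis using D0 m S by (simp add: ennreal_le_iff)
qed

text \<open>With \<open>x\<close> in \<open>K\<close> close to \<open>u y\<close>, the values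
  \<open>f (\<tau> + y) x\<close> and \<open>f y x\<close> are inserted. The point \<open>x\<close>
  is within \<open>2 * \<delta>\<close> of \<open>u (\<tau> + y)\<close> and within
  \<open>\<delta>\<close> of \<open>u y\<close>, which gives the factor \<open>3 * \<delta>\<close>;
  the middle difference is left to the almost periods of \<open>f\<close>.\<close>

lemma solution_operator_shift_le:
  assumes u: "continuous_on UNIV u" "bounded (range u)"
    and K: "finite K" "\<And>a. \<exists>y\<in>K. norm (u a - y) \<le> \<delta>"
    and \<tau>: "\<And>t. norm (u (t + \<tau>) - u t) \<le> \<delta>"
    and f\<tau>: "\<And>x t. x \<in> K \<Longrightarrow> lp_norm (ennreal p) (lebesgue_on {0..1}) (\<lambda>s. f (t + \<tau> + s) x - f (t + s) x) \<le> ennreal e"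
    and e: "0 \<le> e"
  shows "norm (solution_operator u (t + \<tau>) - solution_operator u t) \<le> m * S * (3 * \<delta>) + real (card K) * (m * e)"
proof -
  have \<delta>: "0 \<le> \<delta>" using \<tau>[of 0] norm_ge_zero order_trans by blast
  let ?g = "\<lambda>x s. f (\<tau> + s) x - f s x"
  have g_sm: "strongly_measurable lebesgue (?g x)" for x
    by (intro strongly_measurable_diff strongly_measurable_translate strongly_measurable_f)
  have g_le: "(\<integral>\<^sup>+s. ennreal (norm (T s) * norm (?g x (t - s))) \<partial>lebesgue_on {0<..}) \<le> ennreal (m * e)" if "x \<in> K" for x
    using f\<tau>[OF that] e by (intro convolution_le g_sm) (auto simp: add_ac)
  note [measurable] = borel_convolution_integrand[OF strongly_measurable_L] borel_convolution_integrand[OF g_sm]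
  let ?D = "\<lambda>s. ennreal (2 * \<delta>) * ennreal (norm (T s) * norm (L (t + \<tau> - s))) + ennreal \<delta> * ennreal (norm (T s) * norm (L (t - s)))"
  have "ennreal (norm (solution_operator u (t + \<tau>) - solution_operator u t)) \<le>
    (\<integral>\<^sup>+s. ?D s + (\<Sum>x\<in>K. ennreal (norm (T s) * norm (?g x (t - s)))) \<partial>lebesgue_on {0<..})"
  proof (rule order_trans[OF solution_operator_diff_le[OF u u] nn_integral_mono])
    fix s
    define y where "y = t - s"
    have y: "t + \<tau> - s = \<tau> + y" by (simp add: y_def)
    obtain x where x: "x \<in> K" "norm (u y - x) \<le> \<delta>" using K(2) by blast
    have "norm (f (\<tau> + y) (u (\<tau> + y)) - f y (u y)) \<le> \<bar>L (\<tau> + y)\<bar> * (2 * \<delta>) + norm (?g x y) + \<bar>L y\<bar> * \<delta>"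
    proof -
      have "norm (u (\<tau> + y) - x) \<le> 2 * \<delta>"
        using norm_diff_triangle_le[OF \<tau>[of y] x(2)] by (simp add: add.commute)
      then have 1: "norm (f (\<tau> + y) (u (\<tau> + y)) - f (\<tau> + y) x) \<le> \<bar>L (\<tau> + y)\<bar> * (2 * \<delta>)"
        by (intro order_trans[OF lipschitz_abs] mult_left_mono) auto
      have 2: "norm (f y x - f y (u y)) \<le> \<bar>L y\<bar> * \<delta>"
        using x(2) by (intro order_trans[OF lipschitz_abs] mult_left_mono) (auto simp: norm_minus_commute)
      show ?thesis by (rule norm_diff_triangle_le[OF norm_diff_triangle_le[OF 1 order_refl] 2])
    qed
    \<comment> \<open>The choice of \<open>x\<close> depends on \<open>s\<close> and need not be
      measurable. The sum over all of \<open>K\<close> is a measurable majorant free of that choice,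
      at the price of the factor \<open>card K\<close>.\<close>
    also have "\<dots> \<le> \<bar>L (\<tau> + y)\<bar> * (2 * \<delta>) + (\<Sum>x\<in>K. norm (?g x y)) + \<bar>L y\<bar> * \<delta>"
      using member_le_sum[OF x(1) _ K(1), of "\<lambda>x. norm (?g x y)"] by simp
    finally have "norm (T s) * norm (f (\<tau> + y) (u (\<tau> + y)) - f y (u y)) \<le>
      norm (T s) * (\<bar>L (\<tau> + y)\<bar> * (2 * \<delta>) + (\<Sum>x\<in>K. norm (?g x y)) + \<bar>L y\<bar> * \<delta>)"
      by (rule mult_left_mono) simp
    also have "\<dots> = 2 * \<delta> * (norm (T s) * norm (L (\<tau> + y))) + \<delta> * (norm (T s) * norm (L y)) + (\<Sum>x\<in>K. norm (T s) * norm (?g x y))"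
      by (simp add: algebra_simps sum_distrib_left)
    finally show "ennreal (norm (T s) * norm (f (t + \<tau> - s) (u (t + \<tau> - s)) - f (t - s) (u (t - s)))) \<le>
      ?D s + (\<Sum>x\<in>K. ennreal (norm (T s) * norm (?g x (t - s))))"
      unfolding y y_def[symmetric] using \<delta>
      by (simp add: ennreal_leI sum_nonneg sum_ennreal flip: ennreal_mult ennreal_plus)
  qed
  also have "\<dots> = ennreal (2 * \<delta>) * (\<integral>\<^sup>+s. ennreal (norm (T s) * norm (L (t + \<tau> - s))) \<partial>lebesgue_on {0<..}) +
      ennreal \<delta> * (\<integral>\<^sup>+s. ennreal (norm (T s) * norm (L (t - s))) \<partial>lebesgue_on {0<..}) +
      (\<Sum>x\<in>K. \<integral>\<^sup>+s. ennreal (norm (T s) * norm (?g x (t - s))) \<partial>lebesgue_on {0<..})"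
    by (subst nn_integral_add; (subst nn_integral_add)?; (subst nn_integral_cmult)?; (subst nn_integral_cmult)?; (subst nn_integral_sum)?) measurable
  also have "\<dots> \<le> ennreal (2 * \<delta>) * ennreal (m * S) + ennreal \<delta> * ennreal (m * S) + (\<Sum>x\<in>K. ennreal (m * e))"
    using convolution_L_le by (intro add_mono mult_left_mono sum_mono g_le) auto
  also have "\<dots> = ennreal (m * S * (3 * \<delta>) + real (card K) * (m * e))"
    using \<delta> m S e by (simp add: ennreal_of_nat_eq_real_of_nat flip: ennreal_mult ennreal_plus)
  finally show ?thesis using \<delta> m S e by (simp add: ennreal_le_iff del: ennreal_plus)
qed

text \<open>The tolerance for \<open>f\<close> depends on the size of \<open>K\<close>, and
  \<open>K\<close> on the tolerance for \<open>u\<close>. Hence \<open>\<delta>\<close>, then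
  \<open>K\<close>, then \<open>e\<close> are chosen, and the smaller tolerance is returned for both
  purposes.\<close>

lemma solution_operator_shift_small:
  assumes u: "almost_periodic u" and \<epsilon>: "0 < \<epsilon>"
  obtains K \<delta> where "finite K" "0 < \<delta>"
    "\<forall>\<tau>. (\<forall>t. norm (u (t + \<tau>) - u t) \<le> \<delta>) \<and>
      (\<forall>x\<in>K. \<forall>t. lp_norm (ennreal p) (lebesgue_on {0..1}) (\<lambda>s. f (t + \<tau> + s) x - f (t + s) x) \<le> ennreal \<delta>) \<longrightarrow>
      (\<forall>t. norm (solution_operator u (t + \<tau>) - solution_operator u t) \<le> \<epsilon>)"
proof -
  \<comment> \<open>The 6 is 3 from the shift estimate times 2 for half of
    \<open>\<epsilon>\<close>; adding 1 keeps the denominator positive when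
    \<open>m * S = 0\<close>.\<close>
  define \<delta> where "\<delta> = \<epsilon> / (6 * (m * S + 1))"
  have mS: "0 \<le> m * S" using m S by simp
  have \<delta>: "0 < \<delta>" using \<epsilon> mS by (simp add: \<delta>_def)
  obtain K where K: "finite K" "K \<subseteq> range u" "\<And>a. \<exists>y\<in>K. norm (u a - y) \<le> \<delta>"
    by (rule almost_periodic_range_net[OF u \<delta>]) (rule that)
  define e where "e = \<epsilon> / 2 / ((real (card K) + 1) * (m + 1))"
  have e: "0 < e" using \<epsilon> m by (simp add: e_def)
  have "m * S * (3 * \<delta>) \<le> (m * S + 1) * (3 * \<delta>)" using \<delta> by (intro mult_right_mono) auto
  also have "\<dots> = \<epsilon> / 2" using mS by (simp add: \<delta>_def field_simps)
  finally have 1: "m * S * (3 * \<delta>) \<le> \<epsilon> / 2" .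
  have "real (card K) * (m * e) \<le> (real (card K) + 1) * ((m + 1) * e)"
    using e m by (intro mult_mono) auto
  also have "\<dots> = (real (card K) + 1) * (m + 1) * e" by (simp only: mult.assoc)
  also have "\<dots> = \<epsilon> / 2"
  proof -
    have "(real (card K) + 1) * (m + 1) \<noteq> 0" using m(2) by simp
    then show ?thesis by (metis e_def nonzero_mult_div_cancel_left times_divide_eq_right)
  qed
  finally have 2: "real (card K) * (m * e) \<le> \<epsilon> / 2" .
  have cu: "continuous_on UNIV u" "bounded (range u)"
    using u almost_periodic_bounded by (auto simp: almost_periodic_def)
  show ?thesis
  proof (rule that[OF K(1)])
    show "0 < min \<delta> e" using \<delta> e by simp
  next
    show "\<forall>\<tau>. (\<forall>t. norm (u (t + \<tau>) - u t) \<le> min \<delta> e) \<and>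
      (\<forall>x\<in>K. \<forall>t. lp_norm (ennreal p) (lebesgue_on {0..1}) (\<lambda>s. f (t + \<tau> + s) x - f (t + s) x) \<le> ennreal (min \<delta> e)) \<longrightarrow>
      (\<forall>t. norm (solution_operator u (t + \<tau>) - solution_operator u t) \<le> \<epsilon>)"
    proof (intro allI impI, elim conjE)
      fix \<tau> t
      assume \<tau>: "\<forall>t. norm (u (t + \<tau>) - u t) \<le> min \<delta> e"
        "\<forall>x\<in>K. \<forall>t. lp_norm (ennreal p) (lebesgue_on {0..1}) (\<lambda>s. f (t + \<tau> + s) x - f (t + s) x) \<le> ennreal (min \<delta> e)"
      have "norm (u (t + \<tau>) - u t) \<le> \<delta>" for t
        using \<tau>(1) by simp
      moreover have "lp_norm (ennreal p) (lebesgue_on {0..1}) (\<lambda>s. f (t + \<tau> + s) x - f (t + s) x) \<le> ennreal e"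
        if "x \<in> K" for x t
        by (rule order_trans[OF \<tau>(2)[rule_format, OF that] ennreal_leI]) simp
      ultimately have "norm (solution_operator u (t + \<tau>) - solution_operator u t) \<le> m * S * (3 * \<delta>) + real (card K) * (m * e)"
        by (rule solution_operator_shift_le[OF cu K(1,3) _ _ less_imp_le[OF e]])
      with 1 2 show "norm (solution_operator u (t + \<tau>) - solution_operator u t) \<le> \<epsilon>" by linarith
    qed
  qed
qed

section \<open>Continuity and almost periodicity of the image\<close>

lemma stepanov_close_triangle:
  assumes "0 < \<epsilon>"
    and "lp_norm (ennreal p) (lebesgue_on {0..1}) (\<lambda>s. f (a + s) x - f (b + s) x) \<le> ennreal \<epsilon>"
    and "lp_norm (ennreal p) (lebesgue_on {0..1}) (\<lambda>s. f (b + s) x - f (c + s) x) \<le> ennreal \<epsilon>"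
  shows "lp_norm (ennreal p) (lebesgue_on {0..1}) (\<lambda>s. f (a + s) x - f (c + s) x) \<le> ennreal (4 * \<epsilon>)"
proof -
  have "(\<lambda>s. norm (f (a + s) x - f (b + s) x)) \<in> borel_measurable (lebesgue_on {0..1})" for a b
    by (intro measurable_restrict_space1 borel_norm strongly_measurable_diff
        strongly_measurable_translate[where f="\<lambda>s. f s x"] strongly_measurable_f)
  then show ?thesis using p assms by (intro lp_norm_quasi_triangle) auto
qed

text \<open>The quasimetric lemma for the translates of \<open>f _ x\<close> in the Stepanov norm,
  whose quasi-triangle constant is 4. Continuity comes from \<open>APS\<close> at
  \<open>(t, x)\<close>, almost periods from the compact set \<open>{x}\<close>.\<close>

lemma stepanov_uniformly_continuous:
  assumes "0 < \<epsilon>"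
  shows "\<exists>\<delta>>0. \<forall>s t. \<bar>s - t\<bar> < \<delta> \<longrightarrow>
    lp_norm (ennreal p) (lebesgue_on {0..1}) (\<lambda>\<sigma>. f (s + \<sigma>) x - f (t + \<sigma>) x) \<le> ennreal \<epsilon>"
proof (rule almost_periodic_imp_uniformly_continuous_aux[where C=4 and
      E="\<lambda>\<epsilon> s t. lp_norm (ennreal p) (lebesgue_on {0..1}) (\<lambda>\<sigma>. f (s + \<sigma>) x - f (t + \<sigma>) x) \<le> ennreal \<epsilon>"])
  fix e :: real assume e: "0 < e"
  show "\<exists>\<delta>>0. \<forall>s. \<bar>s - t\<bar> < \<delta> \<longrightarrow>
      lp_norm (ennreal p) (lebesgue_on {0..1}) (\<lambda>\<sigma>. f (s + \<sigma>) x - f (t + \<sigma>) x) \<le> ennreal e" for t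
  proof -
    let ?N = "\<lambda>z. lp_norm (ennreal p) (lebesgue_on {0..1}) (\<lambda>s. f (fst z + s) (snd z) - f (t + s) x)"
    have "(?N \<longlongrightarrow> 0) (at (t, x))"
      using f by (simp add: APS_def Let_def case_prod_beta')
    then have "\<forall>\<^sub>F z in at (t, x). ?N z < ennreal e"
      using e by (intro order_tendstoD(2)) auto
    then obtain d where d: "d > 0" "\<And>z. z \<noteq> (t, x) \<Longrightarrow> dist z (t, x) < d \<Longrightarrow> ?N z < ennreal e"
      unfolding eventually_at by auto
    \<comment> \<open>The limit in \<open>APS\<close> omits the point \<open>(t, x)\<close> itself,
      where the norm is that of the zero function.\<close>
    have "?N (s, x) \<le> ennreal e" if "\<bar>s - t\<bar> < d" for s
    proof (cases "s = t")
      case True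
      then show ?thesis using p by (simp add: lp_norm_zero)
    next
      case False
      then show ?thesis using d(2)[of "(s, x)"] that by (simp add: dist_Pair_Pair dist_real_def)
    qed
    then show ?thesis using d(1) by auto
  qed
  show "\<exists>l>0. \<forall>a. \<exists>\<tau>\<in>{a..a + l}. \<forall>t.
      lp_norm (ennreal p) (lebesgue_on {0..1}) (\<lambda>\<sigma>. f (t + \<tau> + \<sigma>) x - f (t + \<sigma>) x) \<le> ennreal e"
  proof -
    have "\<exists>l>0. \<forall>a. \<exists>\<tau>\<in>{a..a + l}. \<forall>t. \<forall>x'\<in>{x}.
      lp_norm (ennreal p) (lebesgue_on {0..1}) (\<lambda>s. f (t + \<tau> + s) x' - f (t + s) x') \<le> ennreal e"
      using f e unfolding APS_def Let_def by (blast intro: finite_imp_compact)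
    then show ?thesis by simp
  qed
  show "lp_norm (ennreal p) (lebesgue_on {0..1}) (\<lambda>\<sigma>. f (a + \<sigma>) x - f (a + \<sigma>) x) \<le> ennreal e" for a
    using p by (simp add: lp_norm_zero)
next
  fix e a b
  assume "lp_norm (ennreal p) (lebesgue_on {0..1}) (\<lambda>\<sigma>. f (a + \<sigma>) x - f (b + \<sigma>) x) \<le> ennreal e"
  then show "lp_norm (ennreal p) (lebesgue_on {0..1}) (\<lambda>\<sigma>. f (b + \<sigma>) x - f (a + \<sigma>) x) \<le> ennreal e"
    by (subst lp_norm_minus_commute)
qed (use assms stepanov_close_triangle in auto)

text \<open>Any small shift \<open>s - t\<close> satisfies the hypotheses of the shift estimate, by
  uniform continuity of \<open>u\<close> and of the finitely many functions \<open>f _ x\<close>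
  with \<open>x\<close> in \<open>K\<close>.\<close>

lemma continuous_on_solution_operator:
  assumes u: "almost_periodic u"
  shows "continuous_on UNIV (solution_operator u)"
proof -
  have "\<exists>d>0. \<forall>s. dist s t < d \<longrightarrow> dist (solution_operator u s) (solution_operator u t) < \<epsilon>" if "0 < \<epsilon>" for \<epsilon> t
  proof -
    have \<epsilon>2: "0 < \<epsilon> / 2" using that by simp
    obtain K \<delta> where K: "finite K" "0 < \<delta>" and
      small: "\<forall>\<tau>. (\<forall>t. norm (u (t + \<tau>) - u t) \<le> \<delta>) \<and>
      (\<forall>x\<in>K. \<forall>t. lp_norm (ennreal p) (lebesgue_on {0..1}) (\<lambda>s. f (t + \<tau> + s) x - f (t + s) x) \<le> ennreal \<delta>) \<longrightarrow>
      (\<forall>t. norm (solution_operator u (t + \<tau>) - solution_operator u t) \<le> \<epsilon> / 2)"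
      by (rule solution_operator_shift_small[OF u \<epsilon>2]) (rule that)
    obtain d0 where d0: "d0 > 0" "\<And>s t. \<bar>s - t\<bar> < d0 \<Longrightarrow> norm (u s - u t) \<le> \<delta>"
      using almost_periodic_uniformly_continuous[OF u K(2)] by metis
    obtain d where d: "\<And>x. d x > 0" "\<And>x s t. \<bar>s - t\<bar> < d x \<Longrightarrow>
        lp_norm (ennreal p) (lebesgue_on {0..1}) (\<lambda>\<sigma>. f (s + \<sigma>) x - f (t + \<sigma>) x) \<le> ennreal \<delta>"
      using stepanov_uniformly_continuous[OF K(2)] by metis
    define D where "D = Min (insert d0 (d ` K))"
    have D: "0 < D" "D \<le> d0" "\<And>x. x \<in> K \<Longrightarrow> D \<le> d x"
      using K(1) d0(1) d(1) by (auto simp: D_def)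
    have "dist (solution_operator u s) (solution_operator u t) < \<epsilon>" if "dist s t < D" for s
    proof -
      have "norm (solution_operator u (t + (s - t)) - solution_operator u t) \<le> \<epsilon> / 2"
      proof (rule small[rule_format], intro conjI allI ballI)
        show "norm (u (t' + (s - t)) - u t') \<le> \<delta>" for t'
          using that D(2) by (intro d0(2)) (simp add: dist_real_def)
        show "lp_norm (ennreal p) (lebesgue_on {0..1}) (\<lambda>\<sigma>. f (t' + (s - t) + \<sigma>) x - f (t' + \<sigma>) x) \<le> ennreal \<delta>"
          if "x \<in> K" for x t'
          using \<open>dist s t < D\<close> D(3)[OF that] by (intro d(2)) (simp add: dist_real_def)
      qed
      then show ?thesis using \<open>0 < \<epsilon>\<close> by (simp add: dist_norm)
    qed
    then show ?thesis using D(1) by blast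
  qed
  then show ?thesis by (simp add: continuous_on_eq_continuous_at continuous_at_eps_delta)
qed

lemma almost_periodic_solution_operator:
  assumes u: "almost_periodic u"
  shows "almost_periodic (solution_operator u)"
  unfolding almost_periodic_def
proof (intro conjI allI impI continuous_on_solution_operator[OF u])
  fix \<epsilon> :: real assume \<epsilon>: "0 < \<epsilon>"
  obtain K \<delta> where K: "finite K" "0 < \<delta>" and
    small: "\<forall>\<tau>. (\<forall>t. norm (u (t + \<tau>) - u t) \<le> \<delta>) \<and>
    (\<forall>x\<in>K. \<forall>t. lp_norm (ennreal p) (lebesgue_on {0..1}) (\<lambda>s. f (t + \<tau> + s) x - f (t + s) x) \<le> ennreal \<delta>) \<longrightarrow>
    (\<forall>t. norm (solution_operator u (t + \<tau>) - solution_operator u t) \<le> \<epsilon>)"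
    by (rule solution_operator_shift_small[OF u \<epsilon>]) (rule that)
  define Q where "Q e \<tau> \<longleftrightarrow> (\<forall>t. \<forall>x\<in>K. lp_norm (ennreal p) (lebesgue_on {0..1}) (\<lambda>s. f (t + \<tau> + s) x - f (t + s) x) \<le> ennreal e)" for e \<tau>
  have "\<exists>l>0. \<forall>a. \<exists>\<tau>\<in>{a..a + l}. (\<forall>t. norm (u (t + \<tau>) - u t) \<le> \<delta>) \<and> Q \<delta> \<tau>"
  \<comment> \<open>Differences of periods of \<open>f\<close> are again periods up to the
    quasi-triangle constant 4: \<open>t + (a - b)\<close> and \<open>t\<close> are both compared
    with \<open>t - b\<close>.\<close>
  proof (rule almost_periodic_common_periods[OF u, of 4])
    show "\<exists>l>0. \<forall>a. \<exists>\<tau>\<in>{a..a + l}. Q e \<tau>" if "0 < e" for e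
      using f that finite_imp_compact[OF K(1)] unfolding APS_def Let_def Q_def by blast
    show "Q (4 * e) (a - b)" if "0 < e" "Q e a" "Q e b" for e a b
      unfolding Q_def
    proof (intro allI ballI)
      fix t x assume x: "x \<in> K"
      have "lp_norm (ennreal p) (lebesgue_on {0..1}) (\<lambda>s. f (t - b + a + s) x - f (t - b + s) x) \<le> ennreal e"
        using that(2) x unfolding Q_def by blast
      moreover have "lp_norm (ennreal p) (lebesgue_on {0..1}) (\<lambda>s. f (t - b + s) x - f (t - b + b + s) x) \<le> ennreal e"
        using that(3) x unfolding Q_def by (subst lp_norm_minus_commute) blast
      ultimately have "lp_norm (ennreal p) (lebesgue_on {0..1}) (\<lambda>s. f (t - b + a + s) x - f (t - b + b + s) x) \<le> ennreal (4 * e)"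
        by (rule stepanov_close_triangle[OF that(1)])
      moreover have "t - b + a = t + (a - b)" "t - b + b = t" by simp_all
      ultimately show "lp_norm (ennreal p) (lebesgue_on {0..1}) (\<lambda>s. f (t + (a - b) + s) x - f (t + s) x) \<le> ennreal (4 * e)"
        by simp
    qed
  qed (use K in auto)
  then obtain l where l: "l > 0" "\<forall>a. \<exists>\<tau>\<in>{a..a + l}. (\<forall>t. norm (u (t + \<tau>) - u t) \<le> \<delta>) \<and> Q \<delta> \<tau>" by blast
  show "\<exists>l>0. \<forall>a. \<exists>\<tau>\<in>{a..a + l}. \<forall>t. norm (solution_operator u (t + \<tau>) - solution_operator u t) \<le> \<epsilon>"
  proof (intro exI[of _ l] conjI allI l(1))
    fix a
    obtain \<tau> where \<tau>: "\<tau> \<in> {a..a + l}" "\<forall>t. norm (u (t + \<tau>) - u t) \<le> \<delta>" "Q \<delta> \<tau>" using l(2) by blast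
    have "\<forall>t. norm (solution_operator u (t + \<tau>) - solution_operator u t) \<le> \<epsilon>"
      using \<tau>(2,3) small unfolding Q_def by blast
    then show "\<exists>\<tau>\<in>{a..a + l}. \<forall>t. norm (solution_operator u (t + \<tau>) - solution_operator u t) \<le> \<epsilon>"
      using \<tau>(1) by blast
  qed
qed

text \<open>Banach's theorem on the almost periodic functions, a closed subset of the bounded
  continuous functions with the supremum metric. Every almost periodic mild solution is bounded and
  so lies in this subset, which makes the fixed point unique among all candidates.\<close>

lemma ex1_almost_periodic_mild_solution:
  assumes contr: "m * S < 1"
  shows "\<exists>!u. almost_periodic u \<and> mild_solution T f u"
proof -
  define X where "X = {u :: real \<Rightarrow>\<^sub>C 'a. almost_periodic (apply_bcontfun u)}"
  \<comment> \<open>For \<open>u\<close> in \<open>X\<close> the image has been shown to be bounded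
    and continuous, so that \<open>Bcontfun\<close> returns it unchanged; \<open>\<Phi>\<close> is
    evaluated only there.\<close>
  define \<Phi> where "\<Phi> u = Bcontfun (solution_operator (apply_bcontfun u))" for u :: "real \<Rightarrow>\<^sub>C 'a"
  have bcont: "u \<in> bcontfun" if "almost_periodic u" for u :: "real \<Rightarrow> 'a"
    using that almost_periodic_bounded by (auto simp: bcontfun_def almost_periodic_def)
  have \<Phi>: "apply_bcontfun (\<Phi> u) = solution_operator (apply_bcontfun u)" if "u \<in> X" for u
    unfolding \<Phi>_def using that almost_periodic_solution_operator by (auto simp: X_def intro!: Bcontfun_inverse bcont)
  have "closed X"
    unfolding closed_sequential_limits
  proof (intro allI impI, elim conjE)
    fix x :: "nat \<Rightarrow> real \<Rightarrow>\<^sub>C 'a" and l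
    assume x: "\<forall>n. x n \<in> X" and lim: "x \<longlonglongrightarrow> l"
    have "almost_periodic (apply_bcontfun l)"
    proof (rule almost_periodic_uniform_limit)
      fix \<epsilon> :: real assume "0 < \<epsilon>"
      then obtain n where n: "dist (x n) l < \<epsilon>" using lim unfolding lim_sequentially by blast
      have "norm (apply_bcontfun l t - apply_bcontfun (x n) t) \<le> \<epsilon>" for t
        unfolding dist_norm[symmetric] using dist_bounded[of l t "x n"] n by (simp add: dist_commute)
      then show "\<exists>v. almost_periodic v \<and> (\<forall>t. norm (apply_bcontfun l t - v t) \<le> \<epsilon>)"
        using x unfolding X_def by blast
    qed simp
    then show "l \<in> X" by (simp add: X_def)
  qed
  then have "complete X" by (simp add: complete_eq_closed)
  moreover have "const_bcontfun 0 \<in> X"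
    by (simp add: X_def const_bcontfun.rep_eq almost_periodic_const)
  moreover have "\<Phi> ` X \<subseteq> X"
    using \<Phi> almost_periodic_solution_operator by (auto simp: X_def)
  moreover have "dist (\<Phi> u) (\<Phi> v) \<le> m * S * dist u v" if "u \<in> X" "v \<in> X" for u v
  proof (rule dist_bound)
    fix t
    show "dist (apply_bcontfun (\<Phi> u) t) (apply_bcontfun (\<Phi> v) t) \<le> m * S * dist u v"
      unfolding \<Phi>[OF that(1)] \<Phi>[OF that(2)] dist_norm
      by (rule solution_operator_contraction) (auto simp: dist_bounded simp flip: dist_norm)
  qed
  ultimately have "\<exists>!u\<in>X. \<Phi> u = u"
    using m S contr by (intro Banach_fix) auto
  then obtain u where u: "u \<in> X" "\<Phi> u = u" and unique: "\<And>v. v \<in> X \<Longrightarrow> \<Phi> v = v \<Longrightarrow> v = u" by blast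
  show ?thesis
  proof (rule ex1I[of _ "apply_bcontfun u"])
    have "solution_operator (apply_bcontfun u) = apply_bcontfun u" using \<Phi>[OF u(1)] u(2) by simp
    then show "almost_periodic (apply_bcontfun u) \<and> mild_solution T f (apply_bcontfun u)"
      using u(1) by (simp add: X_def mild_solution_iff_fixed_point)
  next
    fix v assume v: "almost_periodic v \<and> mild_solution T f v"
    then have inv: "apply_bcontfun (Bcontfun v) = v" by (intro Bcontfun_inverse bcont) simp
    have "continuous_on UNIV v" "bounded (range v)"
      using v almost_periodic_bounded by (auto simp: almost_periodic_def)
    then have "solution_operator v = v" using v mild_solution_iff_fixed_point by blast
    moreover have "Bcontfun v \<in> X" using v inv by (simp add: X_def)
    ultimately have "Bcontfun v = u" by (intro unique) (simp_all add: \<Phi>_def inv)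
    then show "v = apply_bcontfun u" using inv by simp
  qed
qed

end

section \<open>Reduction to the fixed point argument\<close>

theorem theorem2p8:
  fixes \<A> :: "'a::complex_banach \<Rightarrow> 'a set"
    and T :: "real \<Rightarrow> 'a \<Rightarrow>\<^sub>L 'a"
    and f :: "real \<Rightarrow> 'a \<Rightarrow> 'a"
    and L\<^sub>f :: "real \<Rightarrow> real"
    and c M\<^sub>0 \<beta> p r :: real
    and q' M :: ennreal
  assumes "mlo \<A>"
    and "condition_P \<A> c M\<^sub>0 \<beta>"
    and "\<And>t. t > 0 \<Longrightarrow> T t = degenerate_semigroup \<A> c t"
    and "p > 1"
    and "f \<in> APS p"
    and "r \<ge> max p (p / (p - 1))"
    and "L\<^sub>f \<in> stepanov_space r"
    and "\<And>t x y. norm (f t x - f t y) \<le> L\<^sub>f t * norm (x - y)"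
    and "r = p / (p - 1) \<Longrightarrow> \<beta> = 1"
    and "r > p / (p - 1) \<Longrightarrow>
           ennreal (p * r / (p * r - p - r)) < (if \<beta> = 1 then \<infinity> else ennreal (1 / (1 - \<beta>)))"
    and "q' = (if r = p / (p - 1) then \<infinity> else ennreal (p * r / (p * r - p - r)))"
    and "M = (\<Sum>k. lp_norm q' (lebesgue_on {real k..real k + 1}) T)"
    and "M < \<infinity>"
    and "M * stepanov_norm r L\<^sub>f < 1"
  shows "\<exists>!u. almost_periodic u \<and> mild_solution T f u"
proof -
  obtain m where M: "0 \<le> m" "M = ennreal m" using assms(13) by (cases M) auto
  have "stepanov_norm r L\<^sub>f < \<infinity>" using assms(7) by (simp add: stepanov_space_def)
  then obtain S where Sf: "0 \<le> S" "stepanov_norm r L\<^sub>f = ennreal S" by (cases "stepanov_norm r L\<^sub>f") auto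
  have T: "strongly_measurable (lebesgue_on {0<..}) T"
  proof (rule strongly_measurable_continuous_on)
    show "continuous_on {0<..} T"
      using continuous_on_degenerate_semigroup[OF assms(2)] assms(3)
      by (subst continuous_on_cong[OF refl, of _ _ "degenerate_semigroup \<A> c"]) auto
  qed simp
  have exponent: "q' = \<infinity> \<or> (\<exists>q>0. q' = ennreal q \<and> 1 / q + 1 / p \<le> 1 \<and> 1 / q + 1 / r \<le> 1)"
  proof (cases "r = p / (p - 1)")
    case False
    let ?q = "p * r / (p * r - p - r)"
    have pr: "0 < p" "0 < r" using assms(4,6) by auto
    have "p / (p - 1) < r" using assms(6) False by auto
    then have pos: "0 < p * r - p - r" using assms(4) by (simp add: divide_simps algebra_simps)
    \<comment> \<open>The exponent satisfies \<open>1 / q + 1 / p + 1 / r = 1\<close>, so either of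
      \<open>p\<close> and \<open>r\<close> may be paired with it in the Hoelder estimate on unit
      intervals.\<close>
    have "1 / ?q = 1 - 1 / p - 1 / r" using pr pos by (simp add: divide_simps algebra_simps)
    moreover have "0 < ?q" using pr pos by simp
    ultimately show ?thesis using assms(11) False pr by (intro disjI2 exI[of _ ?q]) auto
  qed (use assms(11) in simp)
  interpret stepanov_inclusion T f L\<^sub>f p r m S q'
    using T exponent assms(4-8,12) M Sf by unfold_locales auto
  have "ennreal (m * S) < 1" using assms(14) M Sf by (simp add: ennreal_mult)
  then show ?thesis using M(1) Sf(1) by (intro ex1_almost_periodic_mild_solution) (simp add: ennreal_less_iff flip: ennreal_1)
qed

end
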